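(* Let $G=(V,E)$ be a graph and let $u,v\in V$ be such that $\{u,v\}$ is linked in $G$ in $\mathbb{R}^3$. Then $\{u,v\}$ is globally linked in $G$ in $\mathbb{R}^2$.
   Context: For a graph $G=(V,E)$ and generic $p:V\to\mathbb{R}^d$ (coordinates algebraically independent over $\mathbb{Q}$), the rigidity matrix $R(G,p)$ has a row for each edge $uv$ with $p(u)-p(v)$ in the $d$ columns of $u$, $p(v)-p(u)$ in those of $v$, zeros elsewhere; $r_d(G)$ denotes its rank (independent of the generic $p$). A vertex pair $\{u,v\}$ is linked in $G$ in $\mathbb{R}^d$ if $r_d(G+uv)=r_d(G)$. For a framework $(G,p)$ in $\mathbb{R}^d$, the pair $\{u,v\}$ is globally linked in $(G,p)$ if every $q:V\to\mathbb{R}^d$ with $\|q(a)-q(b)\|=\|p(a)-p(b)\|$ for all edges $ab\in E$ satisfies $\|q(u)-q(v)\|=\|p(u)-p(v)\|$. The pair is globally linked in $G$ in $\mathbb{R}^d$ if it is globally linked in every generic realization $(G,p)$ in $\mathbb{R}^d$. *)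

theory Defs
  imports "HOL-Analysis.Analysis" "HOL-Library.Poly_Mapping"
begin

text \<open>A finite simple graph \<open>(V, E)\<close> is given by its edge set \<open>E\<close>; the vertex set \<open>V\<close> is the
  universe of the finite type \<open>'v\<close>.\<close>

definition simple_graph :: "'v::finite set set \<Rightarrow> bool" where
  "simple_graph E \<longleftrightarrow> (\<forall>e\<in>E. card e = 2)"

text \<open>Polynomials over the rationals in variables indexed by \<open>'i\<close> are finitely supported
  functions from monomials to coefficients, a monomial being a finitely supported exponent
  function.\<close>

definition poly_value :: "('i \<Rightarrow> real) \<Rightarrow> (('i \<Rightarrow>\<^sub>0 nat) \<Rightarrow>\<^sub>0 rat) \<Rightarrow> real" where
  "poly_value x P =
    (\<Sum>m\<in>Poly_Mapping.keys P. of_rat (Poly_Mapping.lookup P m) *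
       (\<Prod>i\<in>Poly_Mapping.keys m. x i ^ Poly_Mapping.lookup m i))"

definition algebraically_independent :: "('i \<Rightarrow> real) \<Rightarrow> bool" where
  "algebraically_independent x \<longleftrightarrow>
    (\<forall>P :: ('i \<Rightarrow>\<^sub>0 nat) \<Rightarrow>\<^sub>0 rat. poly_value x P = 0 \<longrightarrow> P = 0)"

definition generic :: "('v::finite \<Rightarrow> real^'d) \<Rightarrow> bool" where
  "generic p \<longleftrightarrow> algebraically_independent (\<lambda>(w, i). p w $ i)"

text \<open>Rows are indexed by all sets of vertices; those which are not edges give zero rows, which
  do not affect the rank. The column of the \<open>i\<close>-th coordinate of the vertex \<open>w\<close> has index
  \<open>(w, i)\<close>.\<close>

definition rigidity_matrix ::
    "'v::finite set set \<Rightarrow> ('v \<Rightarrow> real^'d::finite) \<Rightarrow> real^('v \<times> 'd)^('v set)" where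
  "rigidity_matrix E p = (\<chi> e c. case c of (w, i) \<Rightarrow>
     if e \<in> E \<and> w \<in> e then (p w - p (THE x. e = {w, x})) $ i else 0)"

lemma rigidity_matrix_edge:
  assumes "{a, b} \<in> E"
  shows "rigidity_matrix E p $ {a, b} $ (w, i) =
    (if w = a then (p a - p b) $ i else if w = b then (p b - p a) $ i else 0)"
proof -
  have "(THE x. {a, b} = {a, x}) = b" "(THE x. {a, b} = {b, x}) = a"
    by (rule the_equality; auto simp: doubleton_eq_iff)+
  then show ?thesis
    using assms by (auto simp: rigidity_matrix_def)
qed

lemma rigidity_matrix_non_edge:
  "e \<notin> E \<Longrightarrow> rigidity_matrix E p $ e = 0"
  by (simp add: rigidity_matrix_def vec_eq_iff split: prod.split)

text \<open>The dimension is the cardinality of the type \<open>'d\<close>. The rank is the same for all generic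
  \<open>p\<close>, so any choice of \<open>p\<close> will do.\<close>

definition rigidity_rank :: "'d::finite itself \<Rightarrow> 'v::finite set set \<Rightarrow> nat" where
  "rigidity_rank _ E = rank (rigidity_matrix E (SOME p :: 'v \<Rightarrow> real^'d. generic p))"

definition linked :: "'d::finite itself \<Rightarrow> 'v::finite set set \<Rightarrow> 'v \<Rightarrow> 'v \<Rightarrow> bool" where
  "linked d E u v \<longleftrightarrow> rigidity_rank d (insert {u, v} E) = rigidity_rank d E"

definition globally_linked_framework ::
    "'v::finite set set \<Rightarrow> ('v \<Rightarrow> real^'d::finite) \<Rightarrow> 'v \<Rightarrow> 'v \<Rightarrow> bool" where
  "globally_linked_framework E p u v \<longleftrightarrow>
    (\<forall>q :: 'v \<Rightarrow> real^'d.
      (\<forall>a b. {a, b} \<in> E \<longrightarrow> norm (q a - q b) = norm (p a - p b)) \<longrightarrow>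
      norm (q u - q v) = norm (p u - p v))"

definition globally_linked :: "'d::finite itself \<Rightarrow> 'v::finite set set \<Rightarrow> 'v \<Rightarrow> 'v \<Rightarrow> bool" where
  "globally_linked _ E u v \<longleftrightarrow>
    (\<forall>p :: 'v \<Rightarrow> real^'d. generic p \<longrightarrow> globally_linked_framework E p u v)"

end

theory Submission
  imports Defs
begin

text \<open>Let \<open>q\<close> have the same edge lengths as the generic framework \<open>p\<close> in dimension \<open>d\<close>, and call
  \<open>\<omega>\<close> a stress at a function \<open>a\<close> on the vertices if the associated quadratic form
  \<open>\<omega>(a, b) = \<Sum>\<^sub>e \<omega>\<^sub>e (a\<^sub>x - a\<^sub>y) (b\<^sub>x - b\<^sub>y)\<close>, \<open>e = xy\<close>, vanishes for all \<open>b\<close>.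
  Linkedness in dimension \<open>d + 1\<close> gives, for all \<open>h\<close> in a nonempty open set, a stress \<open>\<omega>\<^sub>h\<close> of
  \<open>G + uv\<close> at \<open>h\<close> and at all coordinates of \<open>p\<close>, normalised to \<open>1\<close> on \<open>uv\<close>. Take such an \<open>h\<close>, a
  coordinate \<open>c\<close> of \<open>q\<close>, and a small \<open>t \<noteq> 0\<close>. The difference \<open>\<nu>\<close> of \<open>\<omega>' = \<omega>\<^sub>h\<^sub>+\<^sub>t\<^sub>c\<close> and
  \<open>\<omega> = \<omega>\<^sub>h\<close> is a stress of \<open>G\<close> at \<open>p\<close>, hence at \<open>q\<close> by Connelly's theorem. Therefore
  \<open>0 = \<omega>'(h + t c, c) = \<omega>(h, c) + \<nu>(h, c) + t \<omega>'(c, c) = t \<omega>'(c, c) = t \<omega>(c, c)\<close>.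
  Summing over the coordinates, the squared edge lengths of \<open>q\<close> in \<open>G + uv\<close>, weighted by \<open>\<omega>\<close>, add
  up to zero, as do those of \<open>p\<close>. Since the lengths agree on \<open>G\<close> and \<open>\<omega>\<close> is \<open>1\<close> on \<open>uv\<close>, they agree
  on \<open>uv\<close>. The argument works in every dimension \<open>d\<close>.\<close>

section \<open>Polynomial functions with rational coefficients\<close>

text \<open>The number is only an upper bound for the total degree, so sums stay within a fixed
  bound. It serves to count monomials and to select a relation of least degree. Polynomials are kept
  as functions in order to compose and differentiate them directly.\<close>

inductive ratpoly :: "'i set \<Rightarrow> nat \<Rightarrow> (('i \<Rightarrow> real) \<Rightarrow> real) \<Rightarrow> bool" for I where
  const: "ratpoly I n (\<lambda>_. of_rat c)"
| var_mult: "i \<in> I \<Longrightarrow> ratpoly I n f \<Longrightarrow> ratpoly I (Suc n) (\<lambda>x. x i * f x)"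
| add: "ratpoly I n f \<Longrightarrow> ratpoly I n g \<Longrightarrow> ratpoly I n (\<lambda>x. f x + g x)"

lemma ratpoly_0: "ratpoly I n (\<lambda>_. 0)" and ratpoly_1: "ratpoly I n (\<lambda>_. 1)"
  using ratpoly.const[of I n 0] ratpoly.const[of I n 1] by simp_all

lemma ratpoly_Suc: "ratpoly I n f \<Longrightarrow> ratpoly I (Suc n) f"
  by (induction rule: ratpoly.induct) (auto intro: ratpoly.intros)

lemma ratpoly_mono: "ratpoly I n f \<Longrightarrow> n \<le> m \<Longrightarrow> ratpoly I m f"
  using dec_induct[of n m "\<lambda>k. ratpoly I k f"] ratpoly_Suc by blast

lemma ratpoly_cmult: "ratpoly I n f \<Longrightarrow> ratpoly I n (\<lambda>x. of_rat c * f x)"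
proof (induction rule: ratpoly.induct)
  case (const n d)
  then show ?case
    using ratpoly.const[of I n "c * d"] by (simp add: of_rat_mult)
next
  case (var_mult i n f)
  then show ?case
    using ratpoly.var_mult[OF var_mult.hyps(1) var_mult.IH] by (simp add: mult.left_commute)
next
  case (add n f g)
  then show ?case
    using ratpoly.add[OF add.IH] by (simp add: distrib_left)
qed

lemma ratpoly_mult:
  assumes "ratpoly I n f" "ratpoly I m g"
  shows "ratpoly I (n + m) (\<lambda>x. f x * g x)"
  using assms(1)
proof (induction rule: ratpoly.induct)
  case (const n c)
  show ?case
    using ratpoly_mono[OF ratpoly_cmult[OF assms(2)]] by simp
next
  case (var_mult i n f)
  then show ?case
    using ratpoly.var_mult[OF var_mult.hyps(1) var_mult.IH] by (simp add: mult.assoc)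
next
  case (add n f g)
  then show ?case
    using ratpoly.add[OF add.IH] by (simp add: distrib_right)
qed

lemma ratpoly_sum:
  "(\<And>k. k \<in> K \<Longrightarrow> ratpoly I n (f k)) \<Longrightarrow> ratpoly I n (\<lambda>x. \<Sum>k\<in>K. f k x)"
  by (induction K rule: infinite_finite_induct) (auto intro: ratpoly_0 ratpoly.add)

lemma ratpoly_power: "ratpoly I n f \<Longrightarrow> ratpoly I (k * n) (\<lambda>x. f x ^ k)"
  by (induction k) (auto intro: ratpoly_1 ratpoly_mult)

lemma ratpoly_prod:
  "(\<And>k. k \<in> K \<Longrightarrow> ratpoly I (n k) (f k)) \<Longrightarrow> ratpoly I (\<Sum>k\<in>K. n k) (\<lambda>x. \<Prod>k\<in>K. f k x)"
  by (induction K rule: infinite_finite_induct) (auto intro: ratpoly_1 ratpoly_mult)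

lemma ratpoly_var: "i \<in> I \<Longrightarrow> ratpoly I 1 (\<lambda>x. x i)"
  using ratpoly.var_mult[OF _ ratpoly_1[of I 0]] by simp

definition rational_polynomial :: "'i set \<Rightarrow> (('i \<Rightarrow> real) \<Rightarrow> real) \<Rightarrow> bool" where
  "rational_polynomial I f \<longleftrightarrow> (\<exists>n. ratpoly I n f)"

lemma rational_polynomial_const: "rational_polynomial I (\<lambda>_. of_rat c)"
  unfolding rational_polynomial_def by (blast intro: ratpoly.const)

lemma rational_polynomial_var: "i \<in> I \<Longrightarrow> rational_polynomial I (\<lambda>x. x i)"
  unfolding rational_polynomial_def by (blast intro: ratpoly_var)

lemma rational_polynomial_mult:
  "rational_polynomial I f \<Longrightarrow> rational_polynomial I g \<Longrightarrow> rational_polynomial I (\<lambda>x. f x * g x)"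
  unfolding rational_polynomial_def by (blast intro: ratpoly_mult)

lemma rational_polynomial_add:
  assumes "rational_polynomial I f" "rational_polynomial I g"
  shows "rational_polynomial I (\<lambda>x. f x + g x)"
proof -
  obtain n m where "ratpoly I n f" "ratpoly I m g"
    using assms unfolding rational_polynomial_def by blast
  then have "ratpoly I (max n m) f" "ratpoly I (max n m) g"
    by (auto intro: ratpoly_mono)
  then show ?thesis
    unfolding rational_polynomial_def by (blast intro: ratpoly.add)
qed

lemma rational_polynomial_diff:
  assumes "rational_polynomial I f" "rational_polynomial I g"
  shows "rational_polynomial I (\<lambda>x. f x - g x)"
  using rational_polynomial_add[OF assms(1)
      rational_polynomial_mult[OF rational_polynomial_const[of I "-1"] assms(2)]]
  by simp

lemma rational_polynomial_sum:
  "(\<And>k. k \<in> K \<Longrightarrow> rational_polynomial I (f k)) \<Longrightarrow> rational_polynomial I (\<lambda>x. \<Sum>k\<in>K. f k x)"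
  by (induction K rule: infinite_finite_induct)
    (use rational_polynomial_const[of I 0] in \<open>auto intro: rational_polynomial_add\<close>)

lemma rational_polynomial_prod:
  "(\<And>k. k \<in> K \<Longrightarrow> rational_polynomial I (f k)) \<Longrightarrow> rational_polynomial I (\<lambda>x. \<Prod>k\<in>K. f k x)"
  by (induction K rule: infinite_finite_induct)
    (use rational_polynomial_const[of I 1] in \<open>auto intro: rational_polynomial_mult\<close>)

lemma rational_polynomial_compose:
  assumes "rational_polynomial I f" and G: "\<And>i. i \<in> I \<Longrightarrow> rational_polynomial K (G i)"
  shows "rational_polynomial K (\<lambda>x. f (\<lambda>i. G i x))"
proof -
  obtain n where "ratpoly I n f"
    using assms(1) unfolding rational_polynomial_def by blast
  then show ?thesis
    by (induction rule: ratpoly.induct)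
      (auto intro: rational_polynomial_const rational_polynomial_mult rational_polynomial_add G)
qed

lemma rational_polynomial_tendsto:
  assumes "rational_polynomial I f" and "\<And>i. i \<in> I \<Longrightarrow> ((\<lambda>t. Y t i) \<longlongrightarrow> y i) F"
  shows "((\<lambda>t. f (Y t)) \<longlongrightarrow> f y) F"
proof -
  obtain n where "ratpoly I n f"
    using assms(1) unfolding rational_polynomial_def by blast
  then show ?thesis
    by (induction rule: ratpoly.induct) (auto intro!: tendsto_intros assms(2))
qed

text \<open>\<open>D\<close> consists of the partial derivatives. Differentiating along curves
  avoids a topology on the function space. The clause for \<open>n = 0\<close> is separate because
  \<open>n - 1\<close> is then \<open>0\<close> again, so that the degree bound alone shows no
  drop.\<close>

lemma ratpoly_chain_rule:
  fixes f :: "('i \<Rightarrow> real) \<Rightarrow> real"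
  assumes "finite I" "ratpoly I n f"
  shows "\<exists>D. (\<forall>j. ratpoly I (n - 1) (D j)) \<and> (n = 0 \<longrightarrow> (\<forall>j. D j = (\<lambda>_. 0))) \<and>
    (\<forall>y y' t. (\<forall>j\<in>I. ((\<lambda>t. y t j) has_real_derivative y' j) (at t)) \<longrightarrow>
      ((\<lambda>t. f (y t)) has_real_derivative (\<Sum>j\<in>I. D j (y t) * y' j)) (at t))"
  using assms(2)
proof (induction rule: ratpoly.induct)
  case (const n c)
  then show ?case
    by (intro exI[of _ "\<lambda>_ _. 0"]) (auto intro: ratpoly_0)
next
  case (var_mult i n f)
  then obtain D where D: "\<And>j. ratpoly I (n - 1) (D j)" "\<And>j. n = 0 \<Longrightarrow> D j = (\<lambda>_. 0)"
    and der: "\<And>y y' t. \<forall>j\<in>I. ((\<lambda>t. y t j) has_real_derivative y' j) (at t) \<Longrightarrow>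
      ((\<lambda>t. f (y t)) has_real_derivative (\<Sum>j\<in>I. D j (y t) * y' j)) (at t)"
    by blast
  define D' where "D' j = (\<lambda>x. (if j = i then f x else 0) + x i * D j x)" for j
  \<comment> \<open>For \<open>n = 0\<close> the factor \<open>x i\<close> would exceed the bound,
    but then \<open>D j\<close> is zero.\<close>
  have "ratpoly I n (\<lambda>x. x i * D j x)" for j
  proof (cases n)
    case 0
    then show ?thesis
      using D(2) by (simp add: ratpoly_0)
  next
    case (Suc m)
    then show ?thesis
      using ratpoly.var_mult[OF var_mult.hyps(1) D(1)[of j]] by simp
  qed
  moreover have "ratpoly I n (\<lambda>x. if j = i then f x else 0)" for j
    using var_mult.hyps(2) by (cases "j = i") (auto intro: ratpoly_0)
  ultimately have "ratpoly I n (D' j)" for j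
    unfolding D'_def by (intro ratpoly.add)
  moreover have "((\<lambda>t. y t i * f (y t)) has_real_derivative (\<Sum>j\<in>I. D' j (y t) * y' j)) (at t)"
    if "\<forall>j\<in>I. ((\<lambda>t. y t j) has_real_derivative y' j) (at t)" for y y' t
  proof -
    have "((\<lambda>t. y t i * f (y t)) has_real_derivative
        y' i * f (y t) + (\<Sum>j\<in>I. D j (y t) * y' j) * y t i) (at t)"
      using that der[OF that] var_mult.hyps(1) by (intro DERIV_mult) auto
    also have "y' i * f (y t) + (\<Sum>j\<in>I. D j (y t) * y' j) * y t i = (\<Sum>j\<in>I. D' j (y t) * y' j)"
    proof -
      have "(\<Sum>j\<in>I. D' j (y t) * y' j) =
          (\<Sum>j\<in>I. (if j = i then y' j * f (y t) else 0) + D j (y t) * y' j * y t i)"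
        unfolding D'_def by (intro sum.cong) (auto simp: algebra_simps)
      then show ?thesis
        using assms(1) var_mult.hyps(1) by (simp add: sum.distrib sum_distrib_right)
    qed
    finally show ?thesis .
  qed
  ultimately show ?case
    by (intro exI[of _ D']) auto
next
  case (add n f g)
  obtain D where D: "\<And>j. ratpoly I (n - 1) (D j)" "n = 0 \<longrightarrow> (\<forall>j. D j = (\<lambda>_. 0))"
    and der: "\<And>y y' t. \<forall>j\<in>I. ((\<lambda>t. y t j) has_real_derivative y' j) (at t) \<Longrightarrow>
      ((\<lambda>t. f (y t)) has_real_derivative (\<Sum>j\<in>I. D j (y t) * y' j)) (at t)"
    using add.IH(1) by blast
  obtain D' where D': "\<And>j. ratpoly I (n - 1) (D' j)" "n = 0 \<longrightarrow> (\<forall>j. D' j = (\<lambda>_. 0))"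
    and der': "\<And>y y' t. \<forall>j\<in>I. ((\<lambda>t. y t j) has_real_derivative y' j) (at t) \<Longrightarrow>
      ((\<lambda>t. g (y t)) has_real_derivative (\<Sum>j\<in>I. D' j (y t) * y' j)) (at t)"
    using add.IH(2) by blast
  have "((\<lambda>t. f (y t) + g (y t)) has_real_derivative (\<Sum>j\<in>I. (D j (y t) + D' j (y t)) * y' j)) (at t)"
    if "\<forall>j\<in>I. ((\<lambda>t. y t j) has_real_derivative y' j) (at t)" for y y' t
    using DERIV_add[OF der[OF that] der'[OF that]]
    by (simp add: distrib_right sum.distrib)
  then show ?case
    using D D' by (intro exI[of _ "\<lambda>j x. D j x + D' j x"]) (auto intro: ratpoly.add)
qed

text \<open>Dedekind's argument for the independence of characters, applied to the multiplicative maps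
  given by monomials.\<close>

lemma monomials_independent:
  fixes c :: "('i \<Rightarrow> nat) \<Rightarrow> real"
  assumes "finite M" "finite I" "\<And>m m'. m \<in> M \<Longrightarrow> m' \<in> M \<Longrightarrow> (\<forall>i\<in>I. m i = m' i) \<Longrightarrow> m = m'"
    and "\<And>y. (\<Sum>m\<in>M. c m * (\<Prod>i\<in>I. y i ^ m i)) = 0" and "m \<in> M"
  shows "c m = 0"
  using assms(1,3-5)
proof (induction M arbitrary: c m rule: finite_induct)
  case empty
  then show ?case by simp
next
  case (insert a M)
  define mon where "mon m y = (\<Prod>i\<in>I. y i ^ m i)" for m and y :: "'i \<Rightarrow> real"
  have mon_mult: "mon m (\<lambda>i. y i * z i) = mon m y * mon m z" for m y z
    by (simp add: mon_def power_mult_distrib prod.distrib)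
  have zero: "c a * mon a y + (\<Sum>m\<in>M. c m * mon m y) = 0" for y
    using insert.prems(2)[of y] insert.hyps by (simp add: mon_def)
  have neg: "(\<Sum>m\<in>M. c m * mon m y) = - (c a * mon a y)" for y
    using zero[of y] by linarith
  have cM: "c m = 0" if m: "m \<in> M" for m
  proof -
    have "m \<noteq> a"
      using m insert.hyps by auto
    then obtain i where i: "i \<in> I" "m i \<noteq> a i"
      using insert.prems(1)[of m a] m by auto
    \<comment> \<open>Scaling the coordinate \<open>i\<close> by 2 multiplies the monomial
      \<open>m\<close> by \<open>2 ^ m i\<close>. Subtracting \<open>mon a z\<close> times the
      original relation from the scaled one cancels the term of \<open>a\<close> but not that of
      \<open>m\<close>.\<close>
    define z where "z = (\<lambda>k. if k = i then 2 else 1 :: real)"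
    have mon_z: "mon m' z = 2 ^ m' i" for m'
    proof -
      have "mon m' z = (\<Prod>k\<in>I. if k = i then 2 ^ m' k else 1)"
        unfolding mon_def z_def by (intro prod.cong) auto
      then show ?thesis
        using i(1) \<open>finite I\<close> by simp
    qed
    have "(\<Sum>m\<in>M. (c m * (mon m z - mon a z)) * mon m y) = 0" for y
    proof -
      have "(\<Sum>m\<in>M. (c m * (mon m z - mon a z)) * mon m y) =
          (\<Sum>m\<in>M. c m * mon m (\<lambda>i. y i * z i)) - mon a z * (\<Sum>m\<in>M. c m * mon m y)"
        by (simp add: mon_mult sum_subtractf sum_distrib_left algebra_simps)
      also have "\<dots> = - (c a * mon a (\<lambda>i. y i * z i)) - mon a z * (- (c a * mon a y))"
        using neg by simp
      finally show ?thesis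
        by (simp add: mon_mult)
    qed
    then have "c m * (mon m z - mon a z) = 0"
      using insert.IH[of "\<lambda>m. c m * (mon m z - mon a z)" m] insert.prems(1) m
      unfolding mon_def by auto
    then show ?thesis
      using i(2) by (simp add: mon_z)
  qed
  have "c a = 0"
    using zero[of "\<lambda>_. 1"] cM by (simp add: mon_def)
  then show ?case
    using cM insert.prems(3) by auto
qed

section \<open>Algebraic independence\<close>

lemma poly_value_superset:
  assumes "finite K" "Poly_Mapping.keys P \<subseteq> K"
  shows "poly_value x P = (\<Sum>m\<in>K. of_rat (Poly_Mapping.lookup P m) *
    (\<Prod>i\<in>Poly_Mapping.keys m. x i ^ Poly_Mapping.lookup m i))"
  unfolding poly_value_def using assms
  by (intro sum.mono_neutral_left) (auto simp: in_keys_iff)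

lemma poly_value_add: "poly_value x (P + Q) = poly_value x P + poly_value x Q"
proof -
  let ?K = "Poly_Mapping.keys P \<union> Poly_Mapping.keys Q"
  have "finite ?K" "Poly_Mapping.keys (P + Q) \<subseteq> ?K"
    by (simp_all add: Poly_Mapping.keys_add)
  then show ?thesis
    by (simp add: poly_value_superset[of ?K] lookup_add of_rat_add distrib_right sum.distrib)
qed

lemma poly_value_sum: "poly_value x (\<Sum>k\<in>K. P k) = (\<Sum>k\<in>K. poly_value x (P k))"
proof (induction K rule: infinite_finite_induct)
  case (insert k K)
  then show ?case by (simp add: poly_value_add)
qed (simp_all add: poly_value_def)

lemma poly_value_monomial:
  fixes m :: "'i::finite \<Rightarrow>\<^sub>0 nat"
  shows "poly_value x (Poly_Mapping.single m c) = of_rat c * (\<Prod>i\<in>UNIV. x i ^ Poly_Mapping.lookup m i)"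
proof -
  have "(\<Prod>i\<in>Poly_Mapping.keys m. x i ^ Poly_Mapping.lookup m i) = (\<Prod>i\<in>UNIV. x i ^ Poly_Mapping.lookup m i)"
    by (intro prod.mono_neutral_left) (auto simp: in_keys_iff)
  then show ?thesis
    by (simp add: poly_value_def)
qed

lemma poly_value_full:
  fixes P :: "('i::finite \<Rightarrow>\<^sub>0 nat) \<Rightarrow>\<^sub>0 rat"
  shows "poly_value x P = (\<Sum>m\<in>Poly_Mapping.keys P. of_rat (Poly_Mapping.lookup P m) *
    (\<Prod>i\<in>UNIV. x i ^ Poly_Mapping.lookup m i))"
  unfolding poly_value_def
  by (intro sum.cong arg_cong2[where f = "(*)"] prod.mono_neutral_left refl)
    (auto simp: in_keys_iff)

text \<open>Connects polynomial functions with the formal polynomials in the definition of algebraic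
  independence.\<close>

lemma ratpoly_poly_value:
  fixes f :: "('i::finite \<Rightarrow> real) \<Rightarrow> real"
  assumes "ratpoly UNIV n f"
  shows "\<exists>P. \<forall>x. f x = poly_value x P"
  using assms
proof (induction rule: ratpoly.induct)
  case (const n c)
  show ?case
    by (intro exI[of _ "Poly_Mapping.single 0 c"]) (simp add: poly_value_monomial)
next
  case (var_mult i n f)
  then obtain P where P: "\<And>x. f x = poly_value x P"
    by blast
  let ?Q = "\<Sum>m\<in>Poly_Mapping.keys P.
    Poly_Mapping.single (m + Poly_Mapping.single i 1) (Poly_Mapping.lookup P m)"
  have "x i * f x = poly_value x ?Q" for x
  proof -
    have "(\<Prod>j\<in>UNIV. x j ^ Poly_Mapping.lookup (m + Poly_Mapping.single i 1) j) =
        x i * (\<Prod>j\<in>UNIV. x j ^ Poly_Mapping.lookup m j)" for m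
    proof -
      have "(\<Prod>j\<in>UNIV. x j ^ Poly_Mapping.lookup (m + Poly_Mapping.single i 1) j) =
          (\<Prod>j\<in>UNIV. x j ^ Poly_Mapping.lookup m j * (if j = i then x j else 1))"
        by (intro prod.cong) (auto simp: lookup_add lookup_single power_add)
      then show ?thesis
        by (simp add: prod.distrib)
    qed
    then show ?thesis
      by (simp add: poly_value_sum poly_value_monomial P poly_value_full[of x P] sum_distrib_left
          mult.left_commute)
  qed
  then show ?case
    by blast
next
  case (add n f g)
  then show ?case
    by (metis poly_value_add)
qed

text \<open>This is how genericity is used: a relation satisfied at a generic point comes from the
  zero polynomial and is therefore an identity.\<close>

lemma algebraically_independent_vanishing:
  fixes f :: "('i::finite \<Rightarrow> real) \<Rightarrow> real"
  assumes "algebraically_independent x" "rational_polynomial UNIV f" "f x = 0"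
  shows "f y = 0"
proof -
  obtain P where P: "\<And>x. f x = poly_value x P"
    using assms(2) ratpoly_poly_value unfolding rational_polynomial_def by blast
  then have "P = 0"
    using assms(1,3) unfolding algebraically_independent_def by metis
  then show ?thesis
    by (simp add: P poly_value_def)
qed

section \<open>Existence of algebraically independent points\<close>

lemma poly_value_nonzero:
  fixes P :: "('i::finite \<Rightarrow>\<^sub>0 nat) \<Rightarrow>\<^sub>0 rat"
  assumes "P \<noteq> 0"
  shows "\<exists>x. poly_value x P \<noteq> 0"
proof (rule ccontr)
  assume "\<not> ?thesis"
  then have zero: "poly_value x P = 0" for x
    by blast
  \<comment> \<open>The independence of monomials speaks of plain exponent functions, so the keys
    are reindexed by \<open>lookup\<close>, which \<open>Abs_poly_mapping\<close> undoes.\<close>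
  let ?M = "Poly_Mapping.lookup ` Poly_Mapping.keys P"
  let ?c = "\<lambda>m. real_of_rat (Poly_Mapping.lookup P (Abs_poly_mapping m))"
  have inj: "inj_on Poly_Mapping.lookup (Poly_Mapping.keys P)"
    by (auto intro: inj_onI poly_mapping_eqI)
  obtain m where m: "m \<in> Poly_Mapping.keys P"
    using assms by fastforce
  have "(\<Sum>m\<in>?M. ?c m * (\<Prod>i\<in>UNIV. y i ^ m i)) = 0" for y
    using zero[of y] by (simp add: sum.reindex[OF inj] poly_value_full)
  then have "?c (Poly_Mapping.lookup m) = 0"
    by (intro monomials_independent[of ?M UNIV ?c "Poly_Mapping.lookup m"] finite_imageI finite_keys
        finite imageI m) (simp add: fun_eq_iff)
  then show False
    using m by (simp add: in_keys_iff)
qed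

text \<open>A polynomial is determined by the finite set of its pairs of exponent function and
  coefficient, and there are countably many such pairs.\<close>

lemma countable_rational_polynomials: "countable (UNIV :: (('i::finite \<Rightarrow>\<^sub>0 nat) \<Rightarrow>\<^sub>0 rat) set)"
proof -
  let ?g = "\<lambda>P :: ('i \<Rightarrow>\<^sub>0 nat) \<Rightarrow>\<^sub>0 rat.
    (\<lambda>m. (Poly_Mapping.lookup m, Poly_Mapping.lookup P m)) ` Poly_Mapping.keys P"
  have "inj ?g"
  proof (rule injI)
    fix P Q
    assume eq: "?g P = ?g Q"
    have sub: "Poly_Mapping.lookup P m = Poly_Mapping.lookup Q m"
      if "?g P = ?g Q" "m \<in> Poly_Mapping.keys P" for P Q m
    proof -
      have "(Poly_Mapping.lookup m, Poly_Mapping.lookup P m) \<in> ?g Q"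
        using that by blast
      then show ?thesis
        by (auto simp: lookup_inject)
    qed
    show "P = Q"
    proof (rule poly_mapping_eqI)
      fix m
      show "Poly_Mapping.lookup P m = Poly_Mapping.lookup Q m"
        using sub[OF eq, of m] sub[OF eq[symmetric], of m] by (metis in_keys_iff)
    qed
  qed
  moreover have "countable {A :: (('i \<Rightarrow> nat) \<times> rat) set. finite A}"
    by (rule countable_Collect_finite)
  then have "countable (range ?g)"
    by (rule countable_subset[rotated]) auto
  ultimately show ?thesis
    using countable_image_inj_on by blast
qed

lemma real_polynomial_function_poly_value:
  "real_polynomial_function (\<lambda>t. poly_value (\<lambda>i. a i + t * b i) P)"
  unfolding poly_value_def
  by (intro real_polynomial_function_sum real_polynomial_function.intros(2-4)
      real_polynomial_function_prod real_polynomial_function_power finite_keys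
      real_polynomial_function.intros(1)[OF bounded_linear_ident])

text \<open>By Baire's theorem, since the zero sets of the countably many nonzero rational polynomials
  are closed and contain no ball.\<close>

lemma algebraically_independent_exists:
  "\<exists>x :: 'i::finite \<Rightarrow> real. algebraically_independent x"
proof -
  define Z where "Z P = {x :: real^'i. poly_value (($) x) P \<noteq> 0}" for P
  let ?\<G> = "Z ` (UNIV - {0})"
  have "openin (top_of_set UNIV) (Z P) \<and> UNIV \<subseteq> closure (Z P)" if "P \<noteq> 0" for P
  proof
    have "continuous_on UNIV (\<lambda>x :: real^'i. poly_value (($) x) P)"
      unfolding poly_value_def by (intro continuous_intros)
    then have "open (Z P)"
      unfolding Z_def by (intro open_Collect_neq) auto
    then show "openin (top_of_set UNIV) (Z P)"
      by simp
    show "UNIV \<subseteq> closure (Z P)"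
    proof
      fix a :: "real^'i"
      obtain y where y: "poly_value y P \<noteq> 0"
        using poly_value_nonzero[OF \<open>P \<noteq> 0\<close>] by blast
      \<comment> \<open>On the line from \<open>a\<close> to \<open>y\<close> the polynomial is
        nonzero at \<open>t = 1\<close>. It has finitely many zeros there, and arbitrarily small
        \<open>t > 0\<close> avoid them.\<close>
      define l where "l t = poly_value (\<lambda>i. a $ i + t * (y i - a $ i)) P" for t :: real
      obtain c n where l: "\<And>t. l t = (\<Sum>i\<le>n. c i * t ^ i)"
        using real_polynomial_function_poly_value[of "($) a" "\<lambda>i. y i - a $ i" P]
        unfolding real_polynomial_function_iff_sum l_def by metis
      have "l 1 \<noteq> 0"
        using y by (simp add: l_def)
      then have "finite {t. l t = 0}"
        unfolding l Transcendental.polyfun_finite_roots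
        by (auto intro: ccontr[of "\<exists>i\<le>n. c i \<noteq> 0"])
      show "a \<in> closure (Z P)"
        unfolding closure_approachable
      proof (intro allI impI)
        fix e :: real
        assume "e > 0"
        define b where "b = (\<chi> i. y i - a $ i)"
        define \<delta> where "\<delta> = e / (norm b + 1)"
        have "\<delta> > 0"
          unfolding \<delta>_def using \<open>e > 0\<close> by (simp add: add_nonneg_pos)
        then have "infinite {0<..<\<delta>}"
          by (simp add: infinite_Ioo)
        then have "\<not> {0<..<\<delta>} \<subseteq> {t. l t = 0}"
          using \<open>finite {t. l t = 0}\<close> finite_subset by blast
        then obtain t where t: "0 < t" "t < \<delta>" "l t \<noteq> 0"
          unfolding subset_iff greaterThanLessThan_iff mem_Collect_eq by blast
        have "dist (a + t *\<^sub>R b) a = t * norm b"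
          using t by (simp add: dist_norm)
        also have "\<dots> \<le> t * (norm b + 1)"
          using t by simp
        also have "\<dots> < e"
          using t(2) by (simp add: \<delta>_def pos_less_divide_eq add_nonneg_pos)
        finally have "dist (a + t *\<^sub>R b) a < e" .
        moreover have "($) (a + t *\<^sub>R b) = (\<lambda>i. a $ i + t * (y i - a $ i))"
          by (auto simp: b_def)
        then have "a + t *\<^sub>R b \<in> Z P"
          using t(3) by (simp add: Z_def l_def)
        ultimately show "\<exists>z\<in>Z P. dist z a < e"
          by blast
      qed
    qed
  qed
  moreover have "countable ?\<G>"
    using countable_rational_polynomials by (intro countable_image) (rule countable_subset, auto)
  ultimately have "UNIV \<subseteq> closure (\<Inter>?\<G>)"
    by (intro Baire) auto
  then have "\<Inter>?\<G> \<noteq> {}"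
    by force
  then obtain x where "\<And>P. P \<noteq> 0 \<Longrightarrow> x \<in> Z P"
    by auto
  then have "algebraically_independent (($) x)"
    unfolding algebraically_independent_def Z_def by auto
  then show ?thesis
    by (rule exI[where x = "($) x"])
qed

section \<open>Algebraic relations by counting monomials\<close>

interpretation rat_real: vector_space "\<lambda>q x. real_of_rat q * x"
  by unfold_locales (simp_all add: algebra_simps of_rat_add of_rat_mult)

text \<open>The monomials are evaluated at one point, so that dimensions over the rationals can be
  compared. Bounding each exponent separately, instead of the total degree, makes the exponents a
  box that is easy to count.\<close>

lemma ratpoly_in_span_monomials:
  fixes f :: "('i::finite \<Rightarrow> real) \<Rightarrow> real"
  assumes "ratpoly UNIV n f"
  shows "f x \<in> rat_real.span ((\<lambda>m. \<Prod>i\<in>UNIV. x i ^ m i) ` {m. \<forall>i. m i \<le> n})"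
  using assms
proof (induction rule: ratpoly.induct)
  case (const n c)
  have "1 \<in> (\<lambda>m. \<Prod>i\<in>UNIV. x i ^ m i) ` {m. \<forall>i. m i \<le> n}"
    by (rule image_eqI[where x = "\<lambda>_. 0"]) simp_all
  then have "of_rat c * 1 \<in> rat_real.span ((\<lambda>m. \<Prod>i\<in>UNIV. x i ^ m i) ` {m. \<forall>i. m i \<le> n})"
    by (intro rat_real.span_scale rat_real.span_base)
  then show ?case by simp
next
  case (var_mult i n f)
  let ?T = "\<lambda>n. (\<lambda>m. \<Prod>i\<in>UNIV. x i ^ m i) ` {m. \<forall>i. m i \<le> n}"
  from var_mult.IH show ?case
  proof (induction rule: rat_real.span_induct_alt)
    case base
    then show ?case
      by (simp add: rat_real.span_zero)
  next
    case (step c a b)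
    then obtain m where m: "\<And>i. m i \<le> n" "a = (\<Prod>i\<in>UNIV. x i ^ m i)"
      by blast
    have "(\<Prod>j\<in>UNIV. x j ^ (m(i := Suc (m i))) j) =
        (\<Prod>j\<in>UNIV. (if j = i then x j else 1) * x j ^ m j)"
      by (intro prod.cong) auto
    then have "x i * a = (\<Prod>j\<in>UNIV. x j ^ (m(i := Suc (m i))) j)"
      by (simp add: m prod.distrib)
    then have "x i * a \<in> ?T (Suc n)"
      using m(1) by (intro image_eqI[where x = "m(i := Suc (m i))"]) (auto simp: le_SucI)
    then have "of_rat c * (x i * a) + x i * b \<in> rat_real.span (?T (Suc n))"
      by (intro rat_real.span_add rat_real.span_scale step.IH rat_real.span_base[of "x i * a"])
    then show ?case
      by (simp add: algebra_simps)
  qed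
next
  case (add n f g)
  then show ?case
    by (intro rat_real.span_add)
qed

text \<open>The number of monomials of degree at most \<open>N\<close> in each \<open>H j\<close> grows faster with \<open>N\<close> than the
  number of monomials in the variables that are needed to write these down.\<close>

lemma algebraic_relation_exists:
  fixes x :: "'i::finite \<Rightarrow> real" and H :: "'k \<Rightarrow> ('i \<Rightarrow> real) \<Rightarrow> real"
  assumes J: "finite J" "CARD('i) < card J"
    and H: "\<And>j. j \<in> J \<Longrightarrow> rational_polynomial UNIV (H j)"
  shows "\<exists>N g. ratpoly J N g \<and> (\<exists>y. g y \<noteq> 0) \<and> g (\<lambda>j. H j x) = 0"
proof -
  obtain n where n: "\<And>j. j \<in> J \<Longrightarrow> ratpoly UNIV (n j) (H j)"
    using H unfolding rational_polynomial_def by metis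
  define d where "d = (\<Sum>j\<in>J. n j)"
  have d: "ratpoly UNIV d (H j)" if "j \<in> J" for j
    using n[OF that] by (rule ratpoly_mono) (simp add: d_def J(1) member_le_sum that)
  define k where "k = card J"
  \<comment> \<open>With this \<open>N\<close>, the bound
    \<open>K + 1 \<le> (d * k + 1) * (N + 1)\<close> gives
    \<open>(K + 1) ^ CARD('i) \<le> N * (N + 1) ^ CARD('i)\<close>. As \<open>k\<close> exceeds
    \<open>CARD('i)\<close>, this is less than \<open>(N + 1) ^ k\<close>.\<close>
  define N where "N = (d * k + 1) ^ CARD('i)"
  define K where "K = k * N * d"
  define M where "M = PiE J (\<lambda>_. {..N})"
  define val where "val m = (\<Prod>j\<in>J. H j x ^ m j)" for m
  define T where "T = (\<lambda>m. \<Prod>i\<in>UNIV. x i ^ m i) ` {m :: 'i \<Rightarrow> nat. \<forall>i. m i \<le> K}"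
  have finM: "finite M"
    unfolding M_def using J(1) by (intro finite_PiE) auto
  have box: "{m :: 'i \<Rightarrow> nat. \<forall>i. m i \<le> K} = PiE UNIV (\<lambda>_. {..K})"
    by (auto simp: PiE_def)
  then have "finite {m :: 'i \<Rightarrow> nat. \<forall>i. m i \<le> K}"
    by (simp add: finite_PiE)
  then have finT: "finite T" and "card T \<le> card {m :: 'i \<Rightarrow> nat. \<forall>i. m i \<le> K}"
    unfolding T_def by (auto intro: card_image_le)
  moreover have "card {m :: 'i \<Rightarrow> nat. \<forall>i. m i \<le> K} = (K + 1) ^ CARD('i)"
    unfolding box by (simp add: card_PiE)
  moreover have "(K + 1) ^ CARD('i) < (N + 1) ^ k"
  proof -
    have "K + 1 \<le> (d * k + 1) * (N + 1)"
      by (simp add: K_def algebra_simps)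
    then have "(K + 1) ^ CARD('i) \<le> N * (N + 1) ^ CARD('i)"
      unfolding N_def power_mult_distrib[symmetric] by (rule power_mono) simp
    also have "\<dots> < (N + 1) ^ Suc (CARD('i))"
      by simp
    also have "\<dots> \<le> (N + 1) ^ k"
      using J(2) by (intro power_increasing) (auto simp: k_def)
    finally show ?thesis .
  qed
  moreover have "card M = (N + 1) ^ k"
    unfolding M_def using J(1) by (simp add: card_PiE k_def)
  ultimately have card: "card T < card M"
    by simp
  have deg: "(\<Sum>j\<in>J. m j) \<le> k * N" if "m \<in> M" for m
    using sum_bounded_above[of J m N] that by (auto simp: M_def k_def)
  have val_span: "val m \<in> rat_real.span T" if "m \<in> M" for m
  proof -
    have "ratpoly UNIV (\<Sum>j\<in>J. m j * d) (\<lambda>x. \<Prod>j\<in>J. H j x ^ m j)"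
      by (intro ratpoly_prod ratpoly_power d)
    then have "ratpoly UNIV K (\<lambda>x. \<Prod>j\<in>J. H j x ^ m j)"
      by (rule ratpoly_mono) (use deg[OF that] in \<open>simp add: K_def flip: sum_distrib_right\<close>)
    from ratpoly_in_span_monomials[OF this, of x] show ?thesis
      by (simp add: val_def T_def)
  qed
  \<comment> \<open>Linear dependence of a set does not see repetitions. If two monomials take the
    same value, their difference is the relation; otherwise the dimension count applies.\<close>
  have "\<exists>c. (\<exists>m\<in>M. c m \<noteq> 0) \<and> (\<Sum>m\<in>M. of_rat (c m) * val m) = 0"
  proof (cases "inj_on val M")
    case True
    have "rat_real.dependent (val ` M)"
    proof (rule ccontr)
      assume "rat_real.independent (val ` M)"
      then have "card (val ` M) \<le> card T"
        using rat_real.independent_span_bound[OF finT, of "val ` M"] val_span by auto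
      then show False
        using card by (simp add: card_image[OF True])
    qed
    then obtain a where "\<exists>z\<in>val ` M. a z \<noteq> 0" "(\<Sum>z\<in>val ` M. of_rat (a z) * z) = 0"
      using rat_real.dependent_finite[of "val ` M"] finM by auto
    then show ?thesis
      by (intro exI[of _ "a \<circ> val"]) (auto simp: sum.reindex[OF True])
  next
    case False
    then obtain m m' where m: "m \<in> M" "m' \<in> M" "m \<noteq> m'" "val m = val m'"
      unfolding inj_on_def by blast
    define c :: "('k \<Rightarrow> nat) \<Rightarrow> rat" where
      "c = (\<lambda>l. (if l = m then 1 else 0) - (if l = m' then 1 else 0))"
    have "(\<Sum>l\<in>M. of_rat (c l) * val l) =
        (\<Sum>l\<in>M. (if l = m then val l else 0) - (if l = m' then val l else 0))"
      by (intro sum.cong) (auto simp: c_def)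
    also have "\<dots> = 0"
      using m finM by (simp add: sum_subtractf)
    finally show ?thesis
      using m by (intro exI[of _ c]) (auto simp: c_def intro: bexI[of _ m])
  qed
  then obtain c m where c: "m \<in> M" "c m \<noteq> 0" "(\<Sum>m\<in>M. of_rat (c m) * val m) = 0"
    by blast
  define g where "g y = (\<Sum>m\<in>M. of_rat (c m) * (\<Prod>j\<in>J. y j ^ m j))" for y :: "'k \<Rightarrow> real"
  have "ratpoly J (k * N) g"
    unfolding g_def
  proof (intro ratpoly_sum ratpoly_cmult)
    fix m
    assume "m \<in> M"
    have "ratpoly J (\<Sum>j\<in>J. m j * 1) (\<lambda>y. \<Prod>j\<in>J. y j ^ m j)"
      by (intro ratpoly_prod ratpoly_power ratpoly_var)
    then show "ratpoly J (k * N) (\<lambda>y. \<Prod>j\<in>J. y j ^ m j)"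
      by (rule ratpoly_mono) (use deg[OF \<open>m \<in> M\<close>] in simp)
  qed
  \<comment> \<open>The exponents in \<open>M\<close> are extensional, so distinct ones differ
    somewhere on \<open>J\<close> and their monomials are independent.\<close>
  moreover have "\<exists>y. g y \<noteq> 0"
  proof (rule ccontr)
    assume "\<not> ?thesis"
    then have "real_of_rat (c m) = 0"
      using monomials_independent[OF finM J(1), of "\<lambda>m. real_of_rat (c m)" m] c(1)
      by (auto simp: g_def M_def intro: PiE_ext)
    then show False
      using c(2) by simp
  qed
  moreover have "g (\<lambda>j. H j x) = 0"
    using c(3) by (simp add: g_def val_def)
  ultimately show ?thesis
    by blast
qed

section \<open>Linear dependencies between gradients\<close>

text \<open>A family instead of a set: the vectors of two edges may coincide at special points, and
  this has to count as a dependency.\<close>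

definition independent_family :: "'k set \<Rightarrow> ('k \<Rightarrow> 'a::real_vector) \<Rightarrow> bool" where
  "independent_family B w \<longleftrightarrow> (\<forall>c. (\<Sum>b\<in>B. c b *\<^sub>R w b) = 0 \<longrightarrow> (\<forall>b\<in>B. c b = 0))"

lemma independent_familyD:
  "independent_family B w \<Longrightarrow> (\<Sum>b\<in>B. c b *\<^sub>R w b) = 0 \<Longrightarrow> b \<in> B \<Longrightarrow> c b = 0"
  unfolding independent_family_def by blast

lemma dependent_insert_family:
  assumes "finite B" "independent_family B w" "\<not> independent_family (insert e B) w"
  shows "\<exists>a. w e = (\<Sum>b\<in>B. a b *\<^sub>R w b)"
proof -
  have e: "e \<notin> B"
    using assms(2,3) by (metis insert_absorb)
  obtain c where c: "c e *\<^sub>R w e + (\<Sum>b\<in>B. c b *\<^sub>R w b) = 0" "\<exists>b\<in>insert e B. c b \<noteq> 0"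
    using assms(1,3) e unfolding independent_family_def by auto
  have "c e \<noteq> 0"
    using c independent_familyD[OF assms(2), of c] by auto
  have "(\<Sum>b\<in>B. c b *\<^sub>R w b) = - (c e *\<^sub>R w e)"
    using c(1) by (simp add: eq_neg_iff_add_eq_0 add.commute)
  then have "w e = (- 1 / c e) *\<^sub>R (\<Sum>b\<in>B. c b *\<^sub>R w b)"
    using \<open>c e \<noteq> 0\<close> by simp
  then show ?thesis
    by (intro exI[of _ "\<lambda>b. (- 1 / c e) * c b"]) (simp only: scaleR_sum_right scaleR_scaleR)
qed

text \<open>A maximal independent subfamily of \<open>A\<close> containing \<open>B\<^sub>0\<close>
  spans, since every further vector makes it dependent.\<close>

lemma independent_family_extend:
  assumes "finite A" "B\<^sub>0 \<subseteq> A" "independent_family B\<^sub>0 w"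
  obtains B where "B\<^sub>0 \<subseteq> B" "B \<subseteq> A" "independent_family B w"
    "\<And>e. e \<in> A \<Longrightarrow> \<exists>a. w e = (\<Sum>b\<in>B. a b *\<^sub>R w b)"
proof -
  let ?\<B> = "{B. B\<^sub>0 \<subseteq> B \<and> B \<subseteq> A \<and> independent_family B w}"
  have "finite ?\<B>"
    by (rule finite_subset[of _ "Pow A"]) (use assms(1) in auto)
  moreover have "B\<^sub>0 \<in> ?\<B>"
    using assms by simp
  ultimately obtain B where B: "B \<in> ?\<B>" "\<forall>C\<in>?\<B>. B \<subseteq> C \<longrightarrow> B = C"
    by (meson finite_has_maximal2)
  have finB: "finite B"
    using B(1) assms(1) finite_subset by blast
  have "\<exists>a. w e = (\<Sum>b\<in>B. a b *\<^sub>R w b)" if "e \<in> A" for e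
  proof (cases "e \<in> B")
    case True
    then have "w e = (\<Sum>b\<in>B. (if b = e then 1 else 0) *\<^sub>R w b)"
      using finB by (simp add: if_distrib[of "\<lambda>r. r *\<^sub>R _"] cong: if_cong)
    then show ?thesis
      by (rule exI[where x = "\<lambda>b. if b = e then 1 else 0"])
  next
    case False
    then have "\<not> independent_family (insert e B) w"
      using B that by blast
    moreover have "independent_family B w"
      using B(1) by simp
    ultimately show ?thesis
      using dependent_insert_family[OF finB, of w e] by simp
  qed
  then show ?thesis
    using that[of B] B(1) by simp
qed

lemma sum_case_sum_Inl:
  fixes f :: "'e + 'i \<Rightarrow> 'a::real_vector"
  assumes "finite A" "Inl ` B \<subseteq> A" "A \<subseteq> Inl ` B \<union> range Inr"
  shows "(\<Sum>j\<in>A. case_sum a (\<lambda>_. 0) j *\<^sub>R f j) = (\<Sum>b\<in>B. a b *\<^sub>R f (Inl b))"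
proof -
  have "(\<Sum>j\<in>A. case_sum a (\<lambda>_. 0) j *\<^sub>R f j) = (\<Sum>j\<in>Inl ` B. case_sum a (\<lambda>_. 0) j *\<^sub>R f j)"
    using assms by (intro sum.mono_neutral_right) auto
  then show ?thesis
    by (simp add: sum.reindex)
qed

text \<open>A relation of minimal degree between the polynomials \<open>F b\<close>, \<open>F e\<^sub>0\<close> and complementary
  coordinates does not involve the coordinates. Its differential at the common value of these
  polynomials is then a dependency between the gradients at both points.\<close>

lemma gradient_dependency_transfer:
  fixes F :: "'e \<Rightarrow> ('i::finite \<Rightarrow> real) \<Rightarrow> real" and G :: "'e \<Rightarrow> ('i \<Rightarrow> real) \<Rightarrow> real^'i"
  assumes x: "algebraically_independent x"
    and B: "finite B" "independent_family B (\<lambda>e. G e x)"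
    and poly: "\<And>e. e \<in> insert e\<^sub>0 B \<Longrightarrow> rational_polynomial UNIV (F e)"
    and der: "\<And>e z v. e \<in> insert e\<^sub>0 B \<Longrightarrow>
      ((\<lambda>t. F e (\<lambda>i. z i + t * v $ i)) has_real_derivative G e z \<bullet> v) (at 0)"
    and eq: "\<And>e. e \<in> insert e\<^sub>0 B \<Longrightarrow> F e y = F e x"
    and e\<^sub>0: "e\<^sub>0 \<notin> B" "G e\<^sub>0 x = (\<Sum>b\<in>B. a b *\<^sub>R G b x)"
  shows "G e\<^sub>0 y = (\<Sum>b\<in>B. a b *\<^sub>R G b y)"
proof -
  define H where "H = case_sum F (\<lambda>i z. z i)"
  define W where "W = case_sum (\<lambda>e. G e x) (\<lambda>i. axis i (1::real))"
  have H_simps [simp]: "H (Inl e) = F e" "H (Inr i) = (\<lambda>z. z i)" for e i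
    by (simp_all add: H_def)
  have W_simps [simp]: "W (Inl e) = G e x" "W (Inr i) = axis i 1" for e i
    by (simp_all add: W_def)
  have "independent_family (Inl ` B) W"
    unfolding independent_family_def
  proof (intro allI impI ballI)
    fix c :: "'e + 'i \<Rightarrow> real" and j :: "'e + 'i"
    assume "(\<Sum>j\<in>Inl ` B. c j *\<^sub>R W j) = 0" "j \<in> Inl ` B"
    then show "c j = 0"
      using independent_familyD[OF B(2), of "c \<circ> Inl"] by (auto simp: sum.reindex)
  qed
  \<comment> \<open>Coordinate vectors complete the gradients to a basis. Together with
    \<open>e\<^sub>0\<close> there are then more polynomials than variables, which forces an
    algebraic relation.\<close>
  then obtain A where A: "Inl ` B \<subseteq> A" "A \<subseteq> Inl ` B \<union> range Inr" "independent_family A W"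
    and span_A: "\<And>j. j \<in> Inl ` B \<union> range Inr \<Longrightarrow> \<exists>c. W j = (\<Sum>k\<in>A. c k *\<^sub>R W k)"
    using independent_family_extend[of "Inl ` B \<union> range Inr" "Inl ` B" W] B(1) by auto
  have finA: "finite A"
    using A(2) B(1) finite_subset by fastforce
  have "axis i 1 \<in> span (W ` A)" for i
  proof -
    obtain c where "W (Inr i) = (\<Sum>k\<in>A. c k *\<^sub>R W k)"
      using span_A by blast
    then show ?thesis
      by (auto intro: span_sum span_scale span_base)
  qed
  then have "(Basis :: (real^'i) set) \<subseteq> span (W ` A)"
    by (auto simp: Basis_vec_def)
  then have "UNIV \<subseteq> span (W ` A)"
    using span_mono[of Basis "span (W ` A)"] by (simp add: span_span)
  then have "DIM(real^'i) \<le> card (W ` A)"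
    using dim_le_card[of UNIV "W ` A"] finA by simp
  also have "\<dots> \<le> card A"
    using finA by (rule card_image_le)
  finally have cardA: "CARD('i) \<le> card A"
    by simp
  define J where "J = insert (Inl e\<^sub>0) A"
  have e\<^sub>0A: "Inl e\<^sub>0 \<notin> A"
    using e\<^sub>0(1) A(2) by auto
  have finJ: "finite J" and "CARD('i) < card J"
    using cardA finA e\<^sub>0A by (auto simp: J_def)
  have Inl_J: "e \<in> insert e\<^sub>0 B" if "Inl e \<in> J" for e
    using that A(2) by (auto simp: J_def)
  have H_poly: "rational_polynomial UNIV (H j)" if "j \<in> J" for j
    using that Inl_J poly by (cases j) (auto intro: rational_polynomial_var)
  define \<xi> where "\<xi> = (\<lambda>j. H j x)"
  define rel where "rel N \<longleftrightarrow> (\<exists>g. ratpoly J N g \<and> (\<exists>y. g y \<noteq> 0) \<and> g \<xi> = 0)" for N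
  define N where "N = (LEAST N. rel N)"
  have "\<exists>N. rel N"
    unfolding rel_def \<xi>_def
    using algebraic_relation_exists[of J H x] finJ \<open>CARD('i) < card J\<close> H_poly by blast
  then have "rel N"
    unfolding N_def by (rule LeastI_ex)
  then obtain g where g: "ratpoly J N g" "\<exists>y. g y \<noteq> 0" "g \<xi> = 0"
    unfolding rel_def by blast
  obtain D where D: "\<And>j. ratpoly J (N - 1) (D j)" "N = 0 \<Longrightarrow> \<forall>j. D j = (\<lambda>_. 0)"
    and chain: "\<And>y y' t. \<forall>j\<in>J. ((\<lambda>t. y t j) has_real_derivative y' j) (at t) \<Longrightarrow>
      ((\<lambda>t. g (y t)) has_real_derivative (\<Sum>j\<in>J. D j (y t) * y' j)) (at t)"
    using ratpoly_chain_rule[OF finJ g(1)] by blast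
  \<comment> \<open>A partial derivative vanishing at \<xi> but not identically would be a relation
    of smaller degree.\<close>
  have D_zero: "D j z = 0" if "D j \<xi> = 0" for j z
  proof (rule ccontr)
    assume nz: "D j z \<noteq> 0"
    then have "N \<noteq> 0"
      using D(2) by fastforce
    moreover have "rel (N - 1)"
      unfolding rel_def using D(1) nz that by blast
    then have "N \<le> N - 1"
      unfolding N_def by (rule Least_le)
    ultimately show False
      by simp
  qed
  \<comment> \<open>By the previous step \<open>g\<close> does not depend on the variables whose
    partial derivatives vanish at \<xi>: it is constant on the segment between the two
    arguments.\<close>
  have g_eq: "g f\<^sub>1 = g f\<^sub>2" if agree: "\<And>j. j \<in> J \<Longrightarrow> D j \<xi> = 0 \<or> f\<^sub>1 j = f\<^sub>2 j" for f\<^sub>1 f\<^sub>2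
  proof -
    define Y where "Y t = (\<lambda>j. f\<^sub>1 j + t * (f\<^sub>2 j - f\<^sub>1 j))" for t :: real
    have "((\<lambda>t. g (Y t)) has_real_derivative (\<Sum>j\<in>J. D j (Y t) * (f\<^sub>2 j - f\<^sub>1 j))) (at t)" for t
      by (rule chain) (auto simp: Y_def intro!: derivative_eq_intros)
    moreover have "(\<Sum>j\<in>J. D j (Y t) * (f\<^sub>2 j - f\<^sub>1 j)) = 0" for t
      using agree D_zero by (intro sum.neutral ballI) fastforce
    ultimately have "g (Y 0) = g (Y 1)"
      by (intro DERIV_isconst_all) simp
    then show ?thesis
      by (simp add: Y_def)
  qed
  \<comment> \<open>Genericity of \<open>x\<close> turns the relation into an identity, which can be
    differentiated at \<open>x\<close> and at \<open>y\<close>.\<close>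
  have g_H: "g (\<lambda>j. H j z) = 0" for z
  proof (rule algebraically_independent_vanishing[OF x, of "\<lambda>z. g (\<lambda>j. H j z)"])
    show "rational_polynomial UNIV (\<lambda>z. g (\<lambda>j. H j z))"
      by (rule rational_polynomial_compose[of J g])
        (use g(1) H_poly in \<open>auto simp: rational_polynomial_def\<close>)
    show "g (\<lambda>j. H j x) = 0"
      using g(3) by (simp add: \<xi>_def)
  qed

  have "(\<Sum>j\<in>J. D j \<xi> *\<^sub>R W j) \<bullet> v = 0" for v
  proof -
    have "((\<lambda>t. H j (\<lambda>i. x i + t * v $ i)) has_real_derivative W j \<bullet> v) (at 0)" if "j \<in> J" for j
      using that Inl_J der
      by (cases j) (auto simp: inner_axis' intro!: derivative_eq_intros)
    then have "((\<lambda>t. g (\<lambda>j. H j (\<lambda>i. x i + t * v $ i))) has_real_derivative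
        (\<Sum>j\<in>J. D j \<xi> * (W j \<bullet> v))) (at 0)"
      using chain[of "\<lambda>t j. H j (\<lambda>i. x i + t * v $ i)" "\<lambda>j. W j \<bullet> v" 0] by (simp add: \<xi>_def)
    then have "(\<Sum>j\<in>J. D j \<xi> * (W j \<bullet> v)) = 0"
      using DERIV_unique[OF _ DERIV_const] by (simp add: g_H)
    then show ?thesis
      by (simp add: inner_sum_left)
  qed
  then have sum_J: "(\<Sum>j\<in>J. D j \<xi> *\<^sub>R W j) = 0"
    using inner_eq_zero_iff by blast
  define \<delta> where "\<delta> = D (Inl e\<^sub>0) \<xi>"
  define a' where "a' = case_sum a (\<lambda>_::'i. 0)"
  note sum_A = sum_case_sum_Inl[OF finA A(1,2), of a, folded a'_def]
  \<comment> \<open>Replacing the gradient of \<open>e\<^sub>0\<close> by its expansion leaves a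
    relation within the independent family \<open>A\<close>. It determines the partial derivatives
    up to the factor \<delta> and makes those for coordinates vanish.\<close>
  have "(\<Sum>j\<in>A. (D j \<xi> + \<delta> * a' j) *\<^sub>R W j) = (\<Sum>j\<in>A. D j \<xi> *\<^sub>R W j) + \<delta> *\<^sub>R (\<Sum>j\<in>A. a' j *\<^sub>R W j)"
    by (simp add: scaleR_add_left sum.distrib scaleR_sum_right)
  also have "\<dots> = 0"
    using sum_J finA e\<^sub>0A by (simp add: sum_A J_def \<delta>_def e\<^sub>0(2) add.commute)
  finally have D_A: "D j \<xi> = - \<delta> * a' j" if "j \<in> A" for j
    using independent_familyD[OF A(3), of "\<lambda>j. D j \<xi> + \<delta> * a' j" j] that by simp
  have D_Inr: "D (Inr i) \<xi> = 0" if "Inr i \<in> J" for i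
    using D_A[of "Inr i"] that by (simp add: J_def a'_def)
  \<comment> \<open>Otherwise all partial derivatives would vanish at \<xi>, and \<open>g\<close>
    would be constantly \<open>g \<xi> = 0\<close>.\<close>
  have "\<delta> \<noteq> 0"
  proof
    assume "\<delta> = 0"
    then have "D j \<xi> = 0" if "j \<in> J" for j
      using D_A that by (auto simp: J_def \<delta>_def)
    then have "g z = g \<xi>" for z
      using g_eq by blast
    then show False
      using g(2,3) by simp
  qed

  have "(G e\<^sub>0 y - (\<Sum>b\<in>B. a b *\<^sub>R G b y)) \<bullet> v = 0" for v
  proof -
    \<comment> \<open>The curve follows the polynomial values along \<open>y + t v\<close> but keeps
      the coordinates at \<open>x\<close>, which \<open>g\<close> does not notice. The default
      \<open>F e x\<close> makes \<open>Y 0 = \<xi>\<close> hold at all indices.\<close>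
    define Y where "Y t = case_sum
      (\<lambda>e. if e \<in> insert e\<^sub>0 B then F e (\<lambda>i. y i + t * v $ i) else F e x) x" for t
    define Y' where "Y' = case_sum (\<lambda>e. G e y \<bullet> v) (\<lambda>_::'i. 0)"
    have Y0: "Y 0 = \<xi>"
      using eq by (auto simp: Y_def \<xi>_def fun_eq_iff split: sum.split)
    have "((\<lambda>t. Y t j) has_real_derivative Y' j) (at 0)" if "j \<in> J" for j
      using that Inl_J der by (cases j) (auto simp: Y_def Y'_def)
    then have "((\<lambda>t. g (Y t)) has_real_derivative (\<Sum>j\<in>J. D j \<xi> * Y' j)) (at 0)"
      using chain[of Y Y' 0] by (simp add: Y0)
    moreover have "g (Y t) = 0" for t
    proof -
      have "g (Y t) = g (\<lambda>j. H j (\<lambda>i. y i + t * v $ i))"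
      proof (rule g_eq)
        fix j
        assume "j \<in> J"
        then show "D j \<xi> = 0 \<or> Y t j = H j (\<lambda>i. y i + t * v $ i)"
          using D_Inr Inl_J by (cases j) (auto simp: Y_def)
      qed
      then show ?thesis
        by (simp add: g_H)
    qed
    ultimately have "(\<Sum>j\<in>J. D j \<xi> * Y' j) = 0"
      using DERIV_unique[OF _ DERIV_const] by simp
    moreover have "(\<Sum>j\<in>J. D j \<xi> * Y' j) = \<delta> * Y' (Inl e\<^sub>0) + (\<Sum>j\<in>A. - \<delta> * (a' j *\<^sub>R Y' j))"
      using finA e\<^sub>0A D_A by (simp add: J_def \<delta>_def mult.assoc)
    moreover have "\<dots> = \<delta> * (Y' (Inl e\<^sub>0) - (\<Sum>b\<in>B. a b *\<^sub>R Y' (Inl b)))"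
      unfolding sum_distrib_left[symmetric] sum_A by (simp add: right_diff_distrib)
    ultimately show ?thesis
      using \<open>\<delta> \<noteq> 0\<close> by (simp add: Y'_def inner_diff_left inner_sum_left)
  qed
  then show ?thesis
    using inner_eq_zero_iff by (metis right_minus_eq)
qed

text \<open>Expansions of the gradients in a basis \<open>B\<close> at \<open>x\<close> persist at
  \<open>y\<close>. Both combinations therefore reduce to the same coefficients on \<open>B\<close>,
  and these are zero by independence at \<open>x\<close>.\<close>

lemma gradient_dependency_equal_values:
  fixes F :: "'e \<Rightarrow> ('i::finite \<Rightarrow> real) \<Rightarrow> real" and G :: "'e \<Rightarrow> ('i \<Rightarrow> real) \<Rightarrow> real^'i"
  assumes x: "algebraically_independent x" and finE: "finite E"
    and poly: "\<And>e. e \<in> E \<Longrightarrow> rational_polynomial UNIV (F e)"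
    and der: "\<And>e z v. e \<in> E \<Longrightarrow>
      ((\<lambda>t. F e (\<lambda>i. z i + t * v $ i)) has_real_derivative G e z \<bullet> v) (at 0)"
    and eq: "\<And>e. e \<in> E \<Longrightarrow> F e y = F e x"
    and dep: "(\<Sum>e\<in>E. \<omega> e *\<^sub>R G e x) = 0"
  shows "(\<Sum>e\<in>E. \<omega> e *\<^sub>R G e y) = 0"
proof -
  have "independent_family {} (\<lambda>e. G e x)"
    by (simp add: independent_family_def)
  then obtain B where B: "B \<subseteq> E" "independent_family B (\<lambda>e. G e x)"
    and "\<And>e. e \<in> E \<Longrightarrow> \<exists>a. G e x = (\<Sum>b\<in>B. a b *\<^sub>R G b x)"
    using independent_family_extend[OF finE, of "{}" "\<lambda>e. G e x"] by auto
  then obtain a where a: "\<And>e. e \<in> E \<Longrightarrow> G e x = (\<Sum>b\<in>B. a e b *\<^sub>R G b x)"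
    by metis
  have finB: "finite B"
    using B(1) finE finite_subset by blast
  have a': "G e y = (\<Sum>b\<in>B. a e b *\<^sub>R G b y)" if "e \<in> E - B" for e
    using gradient_dependency_transfer[of x B G e F y "a e"] x finB B poly der eq a that by blast
  define c where "c b = \<omega> b + (\<Sum>e\<in>E-B. \<omega> e * a e b)" for b
  have expand: "(\<Sum>e\<in>E. \<omega> e *\<^sub>R G e z) = (\<Sum>b\<in>B. c b *\<^sub>R G b z)"
    if z: "\<And>e. e \<in> E - B \<Longrightarrow> G e z = (\<Sum>b\<in>B. a e b *\<^sub>R G b z)" for z
  proof -
    have "(\<Sum>e\<in>E. \<omega> e *\<^sub>R G e z) = (\<Sum>e\<in>E-B. \<omega> e *\<^sub>R G e z) + (\<Sum>b\<in>B. \<omega> b *\<^sub>R G b z)"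
      using B(1) finE by (rule sum.subset_diff)
    also have "(\<Sum>e\<in>E-B. \<omega> e *\<^sub>R G e z) = (\<Sum>e\<in>E-B. \<Sum>b\<in>B. (\<omega> e * a e b) *\<^sub>R G b z)"
      by (intro sum.cong) (auto simp: z scaleR_sum_right)
    also have "\<dots> = (\<Sum>b\<in>B. \<Sum>e\<in>E-B. (\<omega> e * a e b) *\<^sub>R G b z)"
      by (rule sum.swap)
    finally show ?thesis
      by (simp add: c_def scaleR_add_left sum.distrib scaleR_sum_left)
  qed
  have "c b = 0" if "b \<in> B" for b
    using independent_familyD[OF B(2), of c b] that dep expand[of x] a by simp
  then show ?thesis
    using expand[OF a'] by simp
qed

section \<open>Linear independence as a polynomial condition\<close>

lemma in_span_family:
  assumes "x \<in> span (w ` B)" "finite B"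
  shows "\<exists>a. x = (\<Sum>b\<in>B. a b *\<^sub>R w b)"
  using assms(1)
proof (induction rule: span_induct_alt)
  case base
  show ?case
    by (intro exI[of _ "\<lambda>_. 0"]) simp
next
  case (step c x y)
  then obtain a b where "y = (\<Sum>b\<in>B. a b *\<^sub>R w b)" "b \<in> B" "x = w b"
    by blast
  moreover have "(\<Sum>k\<in>B. (a k + (if k = b then c else 0)) *\<^sub>R w k) =
      (\<Sum>k\<in>B. a k *\<^sub>R w k + (if k = b then c *\<^sub>R w k else 0))"
    by (intro sum.cong) (auto simp: scaleR_add_left)
  ultimately show ?case
    using assms(2)
    by (intro exI[of _ "\<lambda>k. a k + (if k = b then c else 0)"]) (simp add: sum.distrib)
qed

text \<open>The polynomial is the Gram determinant of the subfamily indexed by \<open>B\<close>, padded by an identity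
  block in order to be indexed by a type.\<close>

lemma independent_family_polynomial:
  fixes w :: "('i \<Rightarrow> real) \<Rightarrow> 'e::finite \<Rightarrow> real^'k"
  assumes poly: "\<And>e k. rational_polynomial UNIV (\<lambda>x. w x e $ k)"
  obtains d where "rational_polynomial UNIV d" "\<And>x. d x \<noteq> 0 \<longleftrightarrow> independent_family B (w x)"
proof
  define A :: "('i \<Rightarrow> real) \<Rightarrow> real^'e^'e" where
    "A x = (\<chi> e f. if e \<in> B \<and> f \<in> B then w x e \<bullet> w x f else if e = f then 1 else 0)" for x
  show "rational_polynomial UNIV (\<lambda>x. det (A x))"
    unfolding det_def
  proof (intro rational_polynomial_sum rational_polynomial_mult rational_polynomial_prod)
    fix \<pi> :: "'e \<Rightarrow> 'e" and e
    show "rational_polynomial UNIV (\<lambda>x :: 'i \<Rightarrow> real. of_int (sign \<pi>))"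
      using rational_polynomial_const[of UNIV "of_int (sign \<pi>)"] by simp
    show "rational_polynomial UNIV (\<lambda>x. A x $ e $ \<pi> e)"
    proof (cases "e \<in> B \<and> \<pi> e \<in> B")
      case True
      then show ?thesis
        by (simp add: A_def inner_vec_def)
          (intro rational_polynomial_sum rational_polynomial_mult poly)
    next
      case False
      then show ?thesis
        using rational_polynomial_const[of UNIV 0] rational_polynomial_const[of UNIV 1]
        by (auto simp: A_def)
    qed
  qed
  fix x
  have A_in: "(A x *v c) $ e = w x e \<bullet> (\<Sum>f\<in>B. c $ f *\<^sub>R w x f)" if "e \<in> B" for e c
  proof -
    have "(A x *v c) $ e = (\<Sum>f\<in>UNIV. if f \<in> B then (w x e \<bullet> w x f) * c $ f else 0)"
      unfolding matrix_vector_mult_def using that by (auto simp: A_def intro!: sum.cong)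
    also have "\<dots> = (\<Sum>f\<in>B. (w x e \<bullet> w x f) * c $ f)"
      by (simp add: sum.If_cases)
    finally show ?thesis
      by (simp add: inner_sum_right mult.commute)
  qed
  have A_out: "(A x *v c) $ e = c $ e" if "e \<notin> B" for e c
    using that
    by (simp add: matrix_vector_mult_def A_def if_distrib[of "\<lambda>r. r * _"] cong: if_cong)
  have "det (A x) \<noteq> 0 \<longleftrightarrow> (\<forall>c. A x *v c = 0 \<longrightarrow> c = 0)"
    by (metis invertible_det_nz invertible_left_inverse matrix_left_invertible_ker)
  also have "\<dots> \<longleftrightarrow> independent_family B (w x)"
  proof
    assume ker: "\<forall>c. A x *v c = 0 \<longrightarrow> c = 0"
    show "independent_family B (w x)"
      unfolding independent_family_def
    proof (intro allI impI ballI)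
      fix c e
      assume c: "(\<Sum>b\<in>B. c b *\<^sub>R w x b) = 0" "e \<in> B"
      define c' :: "real^'e" where "c' = (\<chi> e. if e \<in> B then c e else 0)"
      have "(\<Sum>b\<in>B. c' $ b *\<^sub>R w x b) = 0"
        using c(1) by (simp add: c'_def cong: sum.cong)
      then have "(A x *v c') $ e = 0" for e
        by (cases "e \<in> B") (simp_all add: A_in A_out, simp add: c'_def)
      then have "c' = 0"
        using ker by (simp add: vec_eq_iff)
      then show "c e = 0"
        using c(2) by (auto simp: c'_def vec_eq_iff split: if_splits)
    qed
  next
    assume indep: "independent_family B (w x)"
    show "\<forall>c. A x *v c = 0 \<longrightarrow> c = 0"
    proof (intro allI impI)
      fix c
      assume c: "A x *v c = 0"
      \<comment> \<open>A kernel vector gives a combination \<open>s\<close> orthogonal to every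
        \<open>w x e\<close> with \<open>e \<in> B\<close>, hence to itself.\<close>
      define s where "s = (\<Sum>f\<in>B. c $ f *\<^sub>R w x f)"
      have "s \<bullet> s = (\<Sum>e\<in>B. c $ e * (w x e \<bullet> s))"
        by (subst s_def) (simp add: inner_sum_left)
      also have "\<dots> = 0"
        using A_in[of _ c] c by (simp add: s_def)
      finally have "(\<Sum>f\<in>B. c $ f *\<^sub>R w x f) = 0"
        by (simp add: s_def)
      then have "c $ e = 0" if "e \<in> B" for e
        using independent_familyD[OF indep, of "($) c"] that by blast
      moreover have "c $ e = 0" if "e \<notin> B" for e
        using A_out[OF that, of c] c by simp
      ultimately show "c = 0"
        by (auto simp: vec_eq_iff)
    qed
  qed
  finally show "det (A x) \<noteq> 0 \<longleftrightarrow> independent_family B (w x)" .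
qed

section \<open>Polynomials at partially generic points\<close>

lemma rational_sequence_tendsto:
  obtains r :: "nat \<Rightarrow> 'j \<Rightarrow> rat" where "\<And>j. (\<lambda>n. real_of_rat (r n j)) \<longlonglongrightarrow> y j"
proof -
  have "\<exists>q. y j < real_of_rat q \<and> real_of_rat q < y j + inverse (real (Suc n))" for n j
    by (intro of_rat_dense) simp
  then have "\<exists>r. \<forall>n j. y j < real_of_rat (r n j) \<and> real_of_rat (r n j) < y j + inverse (real (Suc n))"
    by (intro choice allI)
  then obtain r where r: "\<And>n j. y j < real_of_rat (r n j)"
      "\<And>n j. real_of_rat (r n j) < y j + inverse (real (Suc n))"
    by blast
  have "(\<lambda>n. real_of_rat (r n j)) \<longlonglongrightarrow> y j" for j
    by (rule tendsto_sandwich[OF _ _ tendsto_const LIMSEQ_inverse_real_of_nat_add])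
      (use r in \<open>auto intro!: always_eventually less_imp_le\<close>)
  then show ?thesis
    by (rule that)
qed

text \<open>If \<open>f\<close> vanished for all \<open>h\<close>, then every rational choice of the
  free variables would leave a rational polynomial vanishing at \<open>x\<close>, hence everywhere.
  Rational approximation of the remaining coordinates of \<open>y\<close> would give
  \<open>f y = 0\<close>.\<close>

lemma algebraically_independent_extension_nonvanishing:
  fixes f :: "('j::finite \<Rightarrow> real) \<Rightarrow> real" and x :: "'i::finite \<Rightarrow> real"
  assumes x: "algebraically_independent x" and f: "rational_polynomial UNIV f" "f y \<noteq> 0"
    and \<rho>: "inj_on \<rho> S"
  shows "\<exists>h. f (\<lambda>j. if j \<in> S then x (\<rho> j) else h j) \<noteq> 0"
proof (rule ccontr)
  assume "\<not> ?thesis"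
  then have zero: "f (\<lambda>j. if j \<in> S then x (\<rho> j) else h j) = 0" for h
    by blast
  have zero': "f (\<lambda>j. if j \<in> S then y j else real_of_rat (r j)) = 0" for r
  proof -
    \<comment> \<open>The point to be substituted for \<open>x\<close>: as \<rho> is injective on
      \<open>S\<close>, it can have the coordinates of \<open>y\<close> at the indices
      \<open>\<rho> j\<close>.\<close>
    define y' where "y' i = y (inv_into S \<rho> i)" for i
    have "f (\<lambda>j. if j \<in> S then y' (\<rho> j) else real_of_rat (r j)) = 0"
    proof (rule algebraically_independent_vanishing[OF x,
          of "\<lambda>x. f (\<lambda>j. if j \<in> S then x (\<rho> j) else real_of_rat (r j))"])
      have "rational_polynomial UNIV (\<lambda>x. if j \<in> S then x (\<rho> j) else real_of_rat (r j))" for j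
        by (cases "j \<in> S") (auto intro: rational_polynomial_var rational_polynomial_const)
      then show "rational_polynomial UNIV (\<lambda>x. f (\<lambda>j. if j \<in> S then x (\<rho> j) else real_of_rat (r j)))"
        by (rule rational_polynomial_compose[OF f(1)])
    qed (rule zero)
    moreover have "y' (\<rho> j) = y j" if "j \<in> S" for j
      using \<rho> that by (simp add: y'_def)
    ultimately show ?thesis
      by (simp cong: if_cong)
  qed
  obtain r where r: "\<And>j. (\<lambda>n. real_of_rat (r n j)) \<longlonglongrightarrow> y j"
    using rational_sequence_tendsto by metis
  have "(\<lambda>n. f (\<lambda>j. if j \<in> S then y j else real_of_rat (r n j))) \<longlonglongrightarrow> f y"
  proof (rule rational_polynomial_tendsto[OF f(1)])
    show "(\<lambda>n. if j \<in> S then y j else real_of_rat (r n j)) \<longlonglongrightarrow> y j" for j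
      using r[of j] by (cases "j \<in> S") auto
  qed
  then show False
    using f(2) zero' by (simp add: LIMSEQ_const_iff)
qed

section \<open>Equilibrium stresses\<close>

text \<open>Half the sum over ordered pairs avoids orienting the edge and is symmetric and bilinear
  for every set \<open>e\<close>.\<close>

definition edge_form :: "'v set \<Rightarrow> ('v \<Rightarrow> real) \<Rightarrow> ('v \<Rightarrow> real) \<Rightarrow> real" where
  "edge_form e a b = (\<Sum>x\<in>e. \<Sum>y\<in>e. (a x - a y) * (b x - b y)) / 2"

text \<open>The bilinear form of the stress matrix, that is, of the Laplacian weighted by
  \<omega>.\<close>

definition stress_form :: "'v set set \<Rightarrow> ('v set \<Rightarrow> real) \<Rightarrow> ('v \<Rightarrow> real) \<Rightarrow> ('v \<Rightarrow> real) \<Rightarrow> real" where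
  "stress_form E \<omega> a b = (\<Sum>e\<in>E. \<omega> e * edge_form e a b)"

lemma edge_form_pair: "edge_form {x, y} a b = (a x - a y) * (b x - b y)"
  by (cases "x = y") (simp_all add: edge_form_def field_simps)

lemma edge_form_commute: "edge_form e a b = edge_form e b a"
  by (simp add: edge_form_def mult.commute)

lemma edge_form_add_left:
  "edge_form e (\<lambda>w. a w + t * c w) b = edge_form e a b + t * edge_form e c b"
proof -
  have "(\<Sum>x\<in>e. \<Sum>y\<in>e. (a x + t * c x - (a y + t * c y)) * (b x - b y)) =
      (\<Sum>x\<in>e. \<Sum>y\<in>e. (a x - a y) * (b x - b y) + t * ((c x - c y) * (b x - b y)))"
    by (intro sum.cong refl) (simp add: algebra_simps)
  then show ?thesis
    by (simp add: edge_form_def sum.distrib sum_distrib_left add_divide_distrib)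
qed

lemma edge_form_add_right:
  "edge_form e b (\<lambda>w. a w + t * c w) = edge_form e b a + t * edge_form e b c"
  by (simp add: edge_form_commute[of e b] edge_form_add_left)

text \<open>By linearity, equilibrium has to be tested only on the indicators of single vertices,
  which correspond to columns of the rigidity matrix.\<close>

lemma edge_form_sum_indicator:
  fixes b :: "'v::finite \<Rightarrow> real"
  shows "edge_form e a b = (\<Sum>w\<in>UNIV. b w * edge_form e a (indicat_real {w}))"
proof -
  have "edge_form e a (\<lambda>x. \<Sum>w\<in>K. b w * indicat_real {w} x) =
      (\<Sum>w\<in>K. b w * edge_form e a (indicat_real {w}))" if "finite K" for K
    using that
  proof (induction K rule: finite_induct)
    case empty
    show ?case by (simp add: edge_form_def)
  next
    case (insert k K)
    then show ?case
      using edge_form_add_right[of e a "\<lambda>x. \<Sum>w\<in>K. b w * indicat_real {w} x" "b k" "indicat_real {k}"]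
      by (simp only: insert.IH sum.insert[OF insert.hyps] add.commute[of "b k * _"])
  qed
  from this[of UNIV] show ?thesis
    by (simp add: indicator_def if_distrib[of "\<lambda>a. _ * a"] cong: if_cong)
qed

lemma stress_form_commute: "stress_form E \<omega> a b = stress_form E \<omega> b a"
  by (simp add: stress_form_def edge_form_commute[of _ a])

lemma stress_form_add_left:
  "stress_form E \<omega> (\<lambda>w. a w + t * c w) b = stress_form E \<omega> a b + t * stress_form E \<omega> c b"
  by (simp add: stress_form_def edge_form_add_left distrib_left sum.distrib sum_distrib_left
      mult.left_commute)

lemma stress_form_sum_indicator:
  fixes b :: "'v::finite \<Rightarrow> real"
  shows "stress_form E \<omega> a b = (\<Sum>w\<in>UNIV. b w * stress_form E \<omega> a (indicat_real {w}))"
proof -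
  have "stress_form E \<omega> a b = (\<Sum>e\<in>E. \<Sum>w\<in>UNIV. b w * (\<omega> e * edge_form e a (indicat_real {w})))"
    unfolding stress_form_def by (subst edge_form_sum_indicator) (simp add: sum_distrib_left mult.left_commute)
  also have "\<dots> = (\<Sum>w\<in>UNIV. \<Sum>e\<in>E. b w * (\<omega> e * edge_form e a (indicat_real {w})))"
    by (rule sum.swap)
  finally show ?thesis
    by (simp add: stress_form_def sum_distrib_left)
qed

lemma norm_diff_edge_form:
  "(norm (p a - p b))\<^sup>2 = (\<Sum>i\<in>UNIV. edge_form {a, b} (\<lambda>w. p w $ i) (\<lambda>w. p w $ i))"
  for p :: "'v \<Rightarrow> real^'d"
  by (simp add: edge_form_pair power2_norm_eq_inner inner_vec_def)

text \<open>Turns row dependencies into equilibrium of stresses. The edge set \<open>UNIV\<close>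
  gives each pair its row independently of the graph.\<close>

lemma rigidity_matrix_edge_form:
  assumes "card e = 2"
  shows "rigidity_matrix UNIV p $ e $ (w, i) = edge_form e (\<lambda>w. p w $ i) (indicat_real {w})"
proof -
  obtain a b where "e = {a, b}" "a \<noteq> b"
    using assms by (auto simp: card_2_iff)
  then show ?thesis
    by (auto simp: rigidity_matrix_edge edge_form_pair indicator_def)
qed

lemma stress_form_rigidity_matrix:
  assumes "\<And>e. e \<in> E \<Longrightarrow> card e = 2" "(\<Sum>e\<in>E. \<omega> e *\<^sub>R rigidity_matrix UNIV p $ e) = 0"
  shows "stress_form E \<omega> (\<lambda>w. p w $ i) b = 0"
proof -
  have "stress_form E \<omega> (\<lambda>w. p w $ i) (indicat_real {w}) =
      (\<Sum>e\<in>E. \<omega> e *\<^sub>R rigidity_matrix UNIV p $ e) $ (w, i)" for w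
    unfolding stress_form_def by (simp add: rigidity_matrix_edge_form assms(1) cong: sum.cong)
  then show ?thesis
    using assms(2) by (subst stress_form_sum_indicator) simp
qed

text \<open>Due to Connelly.\<close>

lemma stress_equal_edge_lengths:
  fixes p q :: "'v::finite \<Rightarrow> real^'d::finite"
  assumes "generic p" and E: "\<And>e. e \<in> E \<Longrightarrow> card e = 2"
    and len: "\<And>a b. {a, b} \<in> E \<Longrightarrow> norm (q a - q b) = norm (p a - p b)"
    and stress: "\<And>i b. stress_form E \<omega> (\<lambda>w. p w $ i) b = 0"
  shows "stress_form E \<omega> (\<lambda>w. q w $ i) b = 0"
proof -
  \<comment> \<open>\<open>F e\<close> is the squared edge length as a polynomial in all
    coordinates, and \<open>G e\<close> is its gradient, twice the row of the edge in the rigidity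
    matrix.\<close>
  define F where "F e x = (\<Sum>i\<in>UNIV. edge_form e (\<lambda>w. x (w, i)) (\<lambda>w. x (w, i)))"
    for e :: "'v set" and x :: "'v \<times> 'd \<Rightarrow> real"
  define G :: "'v set \<Rightarrow> ('v \<times> 'd \<Rightarrow> real) \<Rightarrow> real^('v \<times> 'd)" where
    "G e x = (\<chi> c. 2 * edge_form e (\<lambda>w. x (w, snd c)) (indicat_real {fst c}))" for e x
  define P where "P = (\<lambda>(w, i). p w $ i)"
  define Q where "Q = (\<lambda>(w, i). q w $ i)"
  have G_inner: "G e x \<bullet> v = (\<Sum>i\<in>UNIV. 2 * edge_form e (\<lambda>w. x (w, i)) (\<lambda>w. v $ (w, i)))" for e x v
  proof -
    have "G e x \<bullet> v =
        (\<Sum>w\<in>UNIV. \<Sum>i\<in>UNIV. 2 * edge_form e (\<lambda>w. x (w, i)) (indicat_real {w}) * v $ (w, i))"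
      by (simp add: inner_vec_def G_def sum.cartesian_product flip: UNIV_Times_UNIV)
        (simp add: case_prod_beta)
    also have "\<dots> =
        (\<Sum>i\<in>UNIV. \<Sum>w\<in>UNIV. 2 * edge_form e (\<lambda>w. x (w, i)) (indicat_real {w}) * v $ (w, i))"
      by (rule sum.swap)
    also have "\<dots> = (\<Sum>i\<in>UNIV. 2 * edge_form e (\<lambda>w. x (w, i)) (\<lambda>w. v $ (w, i)))"
      by (subst (2) edge_form_sum_indicator) (simp add: sum_distrib_left ac_simps)
    finally show ?thesis .
  qed
  have G_sum: "(\<Sum>e\<in>E. \<omega> e *\<^sub>R G e x) $ c =
      2 * stress_form E \<omega> (\<lambda>w. x (w, snd c)) (indicat_real {fst c})" for x c
    by (simp add: G_def stress_form_def sum_distrib_left mult.left_commute)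
  have "(\<Sum>e\<in>E. \<omega> e *\<^sub>R G e Q) = 0"
  proof (rule gradient_dependency_equal_values[where F = F and x = P])
    show "algebraically_independent P"
      using assms(1) by (simp add: generic_def P_def)
    show "rational_polynomial UNIV (F e)" if e: "e \<in> E" for e
    proof -
      obtain a b where "e = {a, b}"
        using E[OF e] by (auto simp: card_2_iff)
      then show ?thesis
        unfolding F_def
        by (simp add: edge_form_pair, intro rational_polynomial_sum rational_polynomial_mult
            rational_polynomial_diff rational_polynomial_var UNIV_I)
    qed
    show "((\<lambda>t. F e (\<lambda>c. z c + t * v $ c)) has_real_derivative G e z \<bullet> v) (at 0)" for e z v
    proof -
      define a\<^sub>0 where "a\<^sub>0 = F e z"
      define a\<^sub>2 where "a\<^sub>2 = F e (($) v)"
      \<comment> \<open>An exact expansion in \<open>t\<close>, since squared lengths are quadratic;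
        the linear coefficient is the derivative.\<close>
      have "F e (\<lambda>c. z c + t * v $ c) = a\<^sub>0 + t * (G e z \<bullet> v) + t\<^sup>2 * a\<^sub>2" for t
        unfolding F_def G_inner a\<^sub>0_def a\<^sub>2_def edge_form_add_left edge_form_add_right
        by (simp add: edge_form_commute[of e "\<lambda>w. v $ (w, _)" "\<lambda>w. z (w, _)"] sum.distrib
            sum_distrib_left power2_eq_square algebra_simps)
      then show ?thesis
        by (auto intro!: derivative_eq_intros)
    qed
    show "F e Q = F e P" if eE: "e \<in> E" for e
    proof -
      obtain a b where e: "e = {a, b}"
        using E[OF eE] by (auto simp: card_2_iff)
      have "F e Q = (norm (q a - q b))\<^sup>2" "F e P = (norm (p a - p b))\<^sup>2"
        unfolding norm_diff_edge_form by (simp_all add: F_def e P_def Q_def)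
      then show ?thesis
        using len eE e by simp
    qed
    have "(\<Sum>e\<in>E. \<omega> e *\<^sub>R G e P) $ c = 0" for c
      unfolding G_sum using stress by (simp add: P_def)
    then show "(\<Sum>e\<in>E. \<omega> e *\<^sub>R G e P) = 0"
      by (simp add: vec_eq_iff)
  qed simp
  then have "stress_form E \<omega> (\<lambda>w. q w $ i) (indicat_real {w}) = 0" for w
    using G_sum[of Q "(w, i)"] by (simp add: Q_def)
  then show ?thesis
    by (subst stress_form_sum_indicator) simp
qed

section \<open>Stresses obtained from linkedness\<close>

lemma rigidity_matrix_UNIV_row:
  "rigidity_matrix E p $ e = (if e \<in> E then rigidity_matrix UNIV p $ e else 0)"
  by (simp add: rigidity_matrix_def vec_eq_iff split: prod.split)

text \<open>Non-edges contribute zero rows, so adding an edge adds one vector to a fixed family, and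
  linkedness becomes membership in a span.\<close>

lemma rank_rigidity_matrix:
  "rank (rigidity_matrix E p) = dim ((\<lambda>e. rigidity_matrix UNIV p $ e) ` E)" (is "_ = dim (?w ` E)")
proof -
  have "span (rows (rigidity_matrix E p)) = span (?w ` E)"
  proof (rule subset_antisym; rule span_minimal[OF _ subspace_span]; rule subsetI)
    fix x
    assume "x \<in> rows (rigidity_matrix E p)"
    then obtain e where "x = rigidity_matrix E p $ e"
      by (auto simp: rows_def row_def)
    then show "x \<in> span (?w ` E)"
      by (auto simp: rigidity_matrix_UNIV_row[of E] intro: span_base span_zero)
  next
    fix x
    assume "x \<in> ?w ` E"
    then obtain e where "e \<in> E" "x = ?w e"
      by blast
    then have "x = rigidity_matrix E p $ e"
      by (simp add: rigidity_matrix_UNIV_row[of E])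
    then show "x \<in> span (rows (rigidity_matrix E p))"
      by (auto simp: rows_def row_def intro: span_base)
  qed
  then show ?thesis
    unfolding row_rank_def by (rule span_eq_dim)
qed

text \<open>Ensures that the point chosen in \<open>rigidity_rank\<close> is generic.\<close>

lemma generic_exists: "\<exists>p :: 'v::finite \<Rightarrow> real^'d::finite. generic p"
proof -
  obtain x :: "'v \<times> 'd \<Rightarrow> real" where "algebraically_independent x"
    using algebraically_independent_exists by blast
  then have "generic (\<lambda>w. \<chi> i. x (w, i))"
    by (simp add: generic_def case_prod_eta)
  then show ?thesis
    by (rule exI[where x = "\<lambda>w. \<chi> i. x (w, i)"])
qed

text \<open>Linkedness is a dependency at one generic point. If \<open>B\<close> is a basis of the
  edge rows there, the Gram determinant of \<open>B\<close> with \<open>{u, v}\<close> vanishes at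
  that point, hence everywhere. So the row of \<open>{u, v}\<close> is a combination of the rows of
  \<open>B\<close> wherever the determinant \<open>d\<close> of \<open>B\<close> alone is nonzero,
  also at points that are not generic.\<close>

lemma linked_stress:
  fixes E :: "'v::finite set set"
  assumes "linked TYPE('d::finite) E u v" "{u, v} \<notin> E"
  obtains d and x\<^sub>0 :: "'v \<times> 'd::finite \<Rightarrow> real" where "rational_polynomial UNIV d" "d x\<^sub>0 \<noteq> 0"
    "\<And>x. d x \<noteq> 0 \<Longrightarrow> \<exists>\<omega>. \<omega> {u, v} = 1 \<and>
      (\<Sum>e\<in>insert {u, v} E. \<omega> e *\<^sub>R rigidity_matrix UNIV (\<lambda>w. \<chi> i. x (w, i)) $ e) = 0"
proof -
  define w where "w x e = rigidity_matrix UNIV (\<lambda>w. \<chi> i. x (w, i)) $ e"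
    for x :: "'v \<times> 'd \<Rightarrow> real" and e :: "'v set"
  have poly: "rational_polynomial UNIV (\<lambda>x. w x e $ c)" for e c
  proof (cases "fst c \<in> e")
    case True
    then show ?thesis
      by (simp add: w_def rigidity_matrix_def case_prod_beta)
        (intro rational_polynomial_diff rational_polynomial_var UNIV_I)
  next
    case False
    then show ?thesis
      using rational_polynomial_const[of UNIV 0]
      by (simp add: w_def rigidity_matrix_def case_prod_beta)
  qed
  define p :: "'v \<Rightarrow> real^'d" where "p = (SOME p. generic p)"
  define x\<^sub>0 where "x\<^sub>0 = (\<lambda>(w, i). p w $ i)"
  have gen: "algebraically_independent x\<^sub>0"
    using someI_ex[OF generic_exists] by (simp add: p_def x\<^sub>0_def generic_def)
  have w_x\<^sub>0: "w x\<^sub>0 = (\<lambda>e. rigidity_matrix UNIV p $ e)"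
    by (simp add: w_def x\<^sub>0_def fun_eq_iff)
  have "dim (insert (w x\<^sub>0 {u, v}) (w x\<^sub>0 ` E)) = dim (w x\<^sub>0 ` E)"
    using assms(1)
    by (simp add: linked_def rigidity_rank_def rank_rigidity_matrix w_x\<^sub>0 flip: p_def)
  then have uv: "w x\<^sub>0 {u, v} \<in> span (w x\<^sub>0 ` E)"
    by (simp add: dim_insert split: if_splits)
  have "independent_family {} (w x\<^sub>0)"
    by (simp add: independent_family_def)
  then obtain B where B: "B \<subseteq> E" "independent_family B (w x\<^sub>0)"
    and span_B: "\<And>e. e \<in> E \<Longrightarrow> \<exists>a. w x\<^sub>0 e = (\<Sum>b\<in>B. a b *\<^sub>R w x\<^sub>0 b)"
    using independent_family_extend[of E "{}" "w x\<^sub>0"] by auto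
  have uv_B: "{u, v} \<notin> B"
    using B(1) assms(2) by blast
  have "w x\<^sub>0 e \<in> span (w x\<^sub>0 ` B)" if "e \<in> E" for e
  proof -
    obtain a where a: "w x\<^sub>0 e = (\<Sum>b\<in>B. a b *\<^sub>R w x\<^sub>0 b)"
      using span_B \<open>e \<in> E\<close> by blast
    show ?thesis
      unfolding a by (intro span_sum span_scale span_base imageI)
  qed
  then have "span (w x\<^sub>0 ` E) \<subseteq> span (w x\<^sub>0 ` B)"
    by (intro span_minimal subspace_span) auto
  then obtain a where a: "w x\<^sub>0 {u, v} = (\<Sum>b\<in>B. a b *\<^sub>R w x\<^sub>0 b)"
    using in_span_family[of "w x\<^sub>0 {u, v}" "w x\<^sub>0" B] uv by auto
  have dep: "\<not> independent_family (insert {u, v} B) (w x\<^sub>0)"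
  proof
    assume indep: "independent_family (insert {u, v} B) (w x\<^sub>0)"
    have "(\<Sum>b\<in>insert {u, v} B. (if b = {u, v} then - 1 else a b) *\<^sub>R w x\<^sub>0 b) =
        - w x\<^sub>0 {u, v} + (\<Sum>b\<in>B. (if b = {u, v} then - 1 else a b) *\<^sub>R w x\<^sub>0 b)"
      using uv_B by simp
    also have "(\<Sum>b\<in>B. (if b = {u, v} then - 1 else a b) *\<^sub>R w x\<^sub>0 b) = w x\<^sub>0 {u, v}"
      unfolding a using uv_B by (intro sum.cong) auto
    finally show False
      using independent_familyD[OF indep, of "\<lambda>b. if b = {u, v} then - 1 else a b" "{u, v}"] by simp
  qed
  obtain d where d: "rational_polynomial UNIV d" "\<And>x. d x \<noteq> 0 \<longleftrightarrow> independent_family B (w x)"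
    using independent_family_polynomial[of w B] poly by metis
  obtain d' where d': "rational_polynomial UNIV d'"
    "\<And>x. d' x \<noteq> 0 \<longleftrightarrow> independent_family (insert {u, v} B) (w x)"
    using independent_family_polynomial[of w "insert {u, v} B"] poly by metis
  have d'_0: "d' x = 0" for x
    using algebraically_independent_vanishing[OF gen d'(1)] d'(2) dep by blast
  show ?thesis
  proof (rule that[of d x\<^sub>0])
    fix x
    assume "d x \<noteq> 0"
    then obtain c where c: "w x {u, v} = (\<Sum>b\<in>B. c b *\<^sub>R w x b)"
      using dependent_insert_family[of B "w x" "{u, v}"] d(2) d'(2) d'_0 by auto
    define \<omega> where "\<omega> e = (if e = {u, v} then 1 else if e \<in> B then - c e else 0)" for e
    have "(\<Sum>e\<in>E. \<omega> e *\<^sub>R w x e) = (\<Sum>e\<in>B. \<omega> e *\<^sub>R w x e)"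
      using B(1) assms(2) by (intro sum.mono_neutral_right) (auto simp: \<omega>_def)
    also have "\<dots> = (\<Sum>e\<in>B. - (c e *\<^sub>R w x e))"
      using uv_B by (intro sum.cong) (auto simp: \<omega>_def)
    finally have "(\<Sum>e\<in>insert {u, v} E. \<omega> e *\<^sub>R w x e) = 0"
      using assms(2) by (simp add: sum_negf c \<omega>_def)
    then show "\<exists>\<omega>. \<omega> {u, v} = 1 \<and>
        (\<Sum>e\<in>insert {u, v} E. \<omega> e *\<^sub>R rigidity_matrix UNIV (\<lambda>w. \<chi> i. x (w, i)) $ e) = 0"
      unfolding w_def by (intro exI[of _ \<omega>]) (simp add: \<omega>_def)
  qed (use d B(2) in auto)
qed

section \<open>Lifting to one more dimension\<close>

theorem linked_imp_globally_linked:
  fixes E :: "'v::finite set set" and u v :: 'v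
  assumes dims: "CARD('k::finite) = Suc CARD('d::finite)"
    and simple: "simple_graph E" and linked: "linked TYPE('k) E u v"
  shows "globally_linked TYPE('d) E u v"
  unfolding globally_linked_def globally_linked_framework_def
proof (intro allI impI)
  fix p q :: "'v \<Rightarrow> real^'d"
  assume gen: "generic p"
    and len: "\<forall>a b. {a, b} \<in> E \<longrightarrow> norm (q a - q b) = norm (p a - p b)"
  show "norm (q u - q v) = norm (p u - p v)"
  proof (cases "u = v \<or> {u, v} \<in> E")
    case True
    then show ?thesis
      using len by auto
  next
    case False
    let ?E = "insert {u, v} E"
    have E: "card e = 2" if "e \<in> E" for e
      using simple that by (simp add: simple_graph_def)
    have E': "card e = 2" if "e \<in> ?E" for e
      using E False that by auto
    from False have "{u, v} \<notin> E"
      by simp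
    then obtain d x\<^sub>0 where d: "rational_polynomial UNIV d" "d (x\<^sub>0 :: 'v \<times> 'k \<Rightarrow> real) \<noteq> 0"
      and stress: "\<And>x. d x \<noteq> 0 \<Longrightarrow> \<exists>\<omega>. \<omega> {u, v} = 1 \<and>
        (\<Sum>e\<in>?E. \<omega> e *\<^sub>R rigidity_matrix UNIV (\<lambda>w. \<chi> i. x (w, i)) $ e) = 0"
      by (rule linked_stress[OF linked]) (rule that)
    \<comment> \<open>Any \<open>z\<close> serves as the additional coordinate, and \<phi> matches
      the others with those of \<open>p\<close>. Thus \<open>X h\<close> is \<open>p\<close> lifted
      by the heights \<open>h\<close>.\<close>
    define z :: 'k where "z = undefined"
    have "card (UNIV - {z}) = CARD('d)"
      using dims by (simp add: card_Diff_singleton)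
    then obtain \<phi> where \<phi>: "bij_betw \<phi> (UNIV - {z}) (UNIV :: 'd set)"
      using finite_same_card_bij[of "UNIV - {z}" "UNIV :: 'd set"] by auto
    define X where "X h = (\<lambda>(w, k). if k = z then h w else p w $ \<phi> k)" for h :: "'v \<Rightarrow> real"
    have good: "\<exists>\<omega>. \<omega> {u, v} = 1 \<and> (\<forall>b. stress_form ?E \<omega> h b = 0) \<and>
        (\<forall>i b. stress_form ?E \<omega> (\<lambda>w. p w $ i) b = 0)" if "d (X h) \<noteq> 0" for h
    proof -
      obtain \<omega> where \<omega>: "\<omega> {u, v} = 1"
        "(\<Sum>e\<in>?E. \<omega> e *\<^sub>R rigidity_matrix UNIV (\<lambda>w. \<chi> i. X h (w, i)) $ e) = 0"
        using stress[OF \<open>d (X h) \<noteq> 0\<close>] by blast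
      have zero: "stress_form ?E \<omega> (\<lambda>w. X h (w, k)) b = 0" for k b
        using stress_form_rigidity_matrix[OF E' \<omega>(2), of k b] by simp
      have "stress_form ?E \<omega> (\<lambda>w. p w $ i) b = 0" for i b
      proof -
        obtain k where "k \<noteq> z" "\<phi> k = i"
          using \<phi> by (metis DiffE UNIV_I bij_betw_imp_surj_on imageE insertI1)
        then show ?thesis
          using zero[of k b] by (simp add: X_def)
      qed
      moreover have "stress_form ?E \<omega> h b = 0" for b
        using zero[of z b] by (simp add: X_def)
      ultimately show ?thesis
        using \<omega>(1) by blast
    qed
    \<comment> \<open>The coordinates other than \<open>z\<close> come from the generic
      \<open>p\<close>, so \<open>d\<close> cannot vanish for all heights.\<close>
    have "\<exists>h. d (\<lambda>j. if j \<in> UNIV \<times> (UNIV - {z}) then (\<lambda>(w, i). p w $ i) (map_prod id \<phi> j) else h j) \<noteq> 0"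
      using gen d \<phi>
      by (intro algebraically_independent_extension_nonvanishing)
        (auto simp: generic_def bij_betw_def inj_on_def)
    then obtain h' where
      "d (\<lambda>j. if j \<in> UNIV \<times> (UNIV - {z}) then (\<lambda>(w, i). p w $ i) (map_prod id \<phi> j) else h' j) \<noteq> 0"
      by blast
    moreover have "(\<lambda>j. if j \<in> UNIV \<times> (UNIV - {z}) then (\<lambda>(w, i). p w $ i) (map_prod id \<phi> j) else h' j) =
        X (\<lambda>w. h' (w, z))"
      by (auto simp: X_def fun_eq_iff)
    ultimately obtain h where h: "d (X h) \<noteq> 0"
      by metis
    then obtain \<omega> where \<omega>: "\<omega> {u, v} = 1" "\<And>b. stress_form ?E \<omega> h b = 0"
      "\<And>i b. stress_form ?E \<omega> (\<lambda>w. p w $ i) b = 0"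
      using good by blast
    have qq: "stress_form ?E \<omega> (\<lambda>w. q w $ i) (\<lambda>w. q w $ i) = 0" for i
    proof -
      let ?q = "\<lambda>w. q w $ i"
      \<comment> \<open>By continuity of \<open>d\<close>, the lift by \<open>h + t * ?q\<close>
        also carries a normalised stress for some small \<open>t \<noteq> 0\<close>.\<close>
      have "((\<lambda>t. d (X (\<lambda>w. h w + t * ?q w))) \<longlongrightarrow> d (X h)) (at 0)"
      proof (rule rational_polynomial_tendsto[OF d(1)])
        fix j :: "'v \<times> 'k"
        have "((\<lambda>t. h (fst j) + t * ?q (fst j)) \<longlongrightarrow> h (fst j) + 0 * ?q (fst j)) (at 0)"
          by (intro tendsto_intros)
        then show "((\<lambda>t. X (\<lambda>w. h w + t * ?q w) j) \<longlongrightarrow> X h j) (at 0)"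
          by (cases "snd j = z") (simp_all add: X_def case_prod_beta)
      qed
      then have "\<forall>\<^sub>F t in at 0. d (X (\<lambda>w. h w + t * ?q w)) \<noteq> 0"
        using h by (rule tendsto_imp_eventually_ne)
      moreover have "\<forall>\<^sub>F t::real in at 0. t \<noteq> 0"
        by (simp add: eventually_at_filter)
      ultimately have "\<forall>\<^sub>F t in at 0. t \<noteq> 0 \<and> d (X (\<lambda>w. h w + t * ?q w)) \<noteq> 0"
        by eventually_elim simp
      then obtain t where t: "t \<noteq> 0" "d (X (\<lambda>w. h w + t * ?q w)) \<noteq> 0"
        using eventually_happens'[OF at_neq_bot] by blast
      then obtain \<omega>' where \<omega>': "\<omega>' {u, v} = 1"
        "\<And>b. stress_form ?E \<omega>' (\<lambda>w. h w + t * ?q w) b = 0"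
        "\<And>i b. stress_form ?E \<omega>' (\<lambda>w. p w $ i) b = 0"
        using good[of "\<lambda>w. h w + t * ?q w"] by blast
      \<comment> \<open>The values 1 on \<open>{u, v}\<close> cancel, so \<nu> is a stress of
        \<open>E\<close> alone, where \<open>p\<close> and \<open>q\<close> have equal
        lengths.\<close>
      define \<nu> where "\<nu> e = \<omega>' e - \<omega> e" for e
      have \<nu>: "stress_form E \<nu> a b = stress_form ?E \<omega>' a b - stress_form ?E \<omega> a b" for a b
        using \<omega>(1) \<omega>'(1) False
        by (simp add: stress_form_def \<nu>_def left_diff_distrib sum_subtractf)
      have \<nu>q: "stress_form E \<nu> ?q b = 0" for b
        by (rule stress_equal_edge_lengths[OF gen]) (use E len \<nu> \<omega>(3) \<omega>'(3) in auto)
      \<comment> \<open>As \<nu> is in equilibrium at \<open>?q\<close>, the forms of \<omega> and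
        \<open>\<omega>'\<close> agree whenever one argument is \<open>?q\<close>.\<close>
      have "stress_form ?E \<omega>' h ?q = 0"
        using \<nu>[of h ?q] \<nu>q[of h] \<omega>(2)[of ?q] by (simp add: stress_form_commute[of E \<nu> h])
      then have "stress_form ?E \<omega>' ?q ?q = 0"
        using \<omega>'(2)[of ?q] t(1) by (simp add: stress_form_add_left)
      then show ?thesis
        using \<nu>[of ?q ?q] \<nu>q[of ?q] by simp
    qed
    define L where "L r e = (\<Sum>i\<in>UNIV. edge_form e (\<lambda>w. r w $ i) (\<lambda>w. r w $ i))"
      for r :: "'v \<Rightarrow> real^'d" and e
    have L_pair: "L r {a, b} = (norm (r a - r b))\<^sup>2" for r a b
      by (simp add: L_def norm_diff_edge_form)
    have L_sum: "(\<Sum>e\<in>?E. \<omega> e * L r e) =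
        (\<Sum>i\<in>UNIV. stress_form ?E \<omega> (\<lambda>w. r w $ i) (\<lambda>w. r w $ i))" for r
      unfolding L_def stress_form_def sum_distrib_left by (rule sum.swap)
    have "(\<Sum>e\<in>?E. \<omega> e * L q e) = (\<Sum>e\<in>?E. \<omega> e * L p e)"
      unfolding L_sum using qq \<omega>(3) by simp
    moreover have "L q e = L p e" if e: "e \<in> E" for e
    proof -
      obtain a b where "e = {a, b}"
        using E[OF e] by (auto simp: card_2_iff)
      then show ?thesis
        using e len by (simp add: L_pair)
    qed
    ultimately have "L q {u, v} = L p {u, v}"
      using \<omega>(1) False by simp
    then show ?thesis
      by (simp add: L_pair)
  qed
qed

theorem theorem4p7:
  fixes E :: "'v::finite set set" and u v :: 'v
  assumes "simple_graph E"
    and "linked TYPE(3) E u v"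
  shows "globally_linked TYPE(2) E u v"
  by (rule linked_imp_globally_linked[OF _ assms]) simp

end
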